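(* Fix network data $(N,\mathcal S,R,f)$ satisfying the standing assumptions, $T>0$, $K>0$ and $\lambda\in\mathbb R_+^N$. Let $\mathcal X$ be the set of all sample paths of this switched network under the MW-$f$ policy. Let $\varepsilon_j\in\mathbb R_+$ and $\lambda^j\in\mathbb R_+^N$ be sequences indexed by $j$ in some totally ordered countable set with $\varepsilon_j\to0$ and $\lambda^j\to\lambda$. Let $G_j\subset C^I(T)\times[1,\infty)$ ($I=3N+|\mathcal S|$) be sets such that each $(\bar x,z)\in G_j$ is of the form: $\bar x$ is the fluid-scaled version with scaling parameter $z$ of some $X\in\mathcal X$ ($z$ may depend on $X$); and $\inf\{z:(\bar x,z)\in G_j\}\to\infty$ as $j\to\infty$; $\sup_{(\bar x,z)\in G_j}\sup_{t\in[0,T]}|\bar a(t)-\lambda^jt|\le\varepsilon_j$ for all $j$; $\sup_{(\bar x,z)\in G_j}|\bar q(0)|\le K$ for all $j$. Then $\sup_{(\bar x,z)\in G_j}d(\bar x,\mathrm{FMS}_K)\to0$ as $j\to\infty$. If moreover $q_0\in\mathbb R_+^N$ and $\varepsilon'_j\to0$ satisfy $\sup_{(\bar x,z)\in G_j}|\bar q(0)-q_0|\le\varepsilon'_j$ for all $j$, then $\sup_{(\bar x,z)\in G_j}d(\bar x,\mathrm{FMS}(q_0))\to0$.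
   Context: Norms: $|x|=\max_i|x_i|$; $C^I(T)$ is the space of continuous maps $[0,T]\to\mathbb R^I$ with $\|g\|=\sup_{t\in[0,T]}|g(t)|$, $d(g,h)=\|g-h\|$, $d(g,\mathcal E)=\inf_{h\in\mathcal E}d(g,h)$. Switched network: $N$ queues; finite schedule set $\mathcal S\subset\mathbb R_+^N$; routing matrix $R\in\{0,1\}^{N\times N}$ with at most one 1 per row, acyclic ($\tilde R=(I-R^T)^{-1}$ exists); $R=0$ is single-hop. A sample path $X=(Q,A,Y,S)$ in discrete time $\tau\in\{0,1,\dots\}$: $A(0)=0$, $A$ nondecreasing (cumulative exogenous arrivals); $B(0)=0$, $dB(\tau)=B(\tau+1)-B(\tau)\in\mathcal S$; $Y(0)=0$, $Y(\tau+1)-Y(\tau)=[dB(\tau)-Q(\tau)]^+$; $S_\pi(\tau)=\#\{\tau'<\tau:dB(\tau')=\pi\}$, so $B(\tau)=\sum_\pi S_\pi(\tau)\pi$; and $Q(\tau)=Q(0)+A(\tau)-(I-R^T)(B(\tau)-Y(\tau))$. MW-$f$ policy: $dB(\tau)\in\arg\max_{\pi\in\mathcal S}\pi\cdot(I-R)f(Q(\tau))$, $f$ componentwise. Standing assumptions: $f:\mathbb R_+\to\mathbb R_+$ differentiable, strictly increasing, $f(0)=0$, and if $\pi$ maximizes $\rho\mapsto\rho\cdot(I-R)f(q)$ over $\mathcal S$ then it maximizes $\rho\mapsto\rho\cdot(I-R)f(\kappa q)$ for every $\kappa\ge0$; in the multi-hop case also: $\pi\in\mathcal S$, $\rho_n\in\{0,\pi_n\}\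 \forall n$ implies $\rho\in\mathcal S$. Fluid scaling: extend $X$ to real time by linear interpolation; for $z\ge1$, $\bar x(t)=(\bar q,\bar a,\bar y,\bar s)(t)=(Q(zt),A(zt),Y(zt),S(zt))/z$, $t\in[0,T]$. Fluid model solution with arrival rate $\lambda$: $x=(q,a,y,s)\in C^I(T)$ with $q,a,y:[0,T]\to\mathbb R_+^N$, $s=(s_\pi)_{\pi\in\mathcal S}$, $s_\pi\ge0$, all components absolutely continuous, satisfying: $q(t)=q(0)+a(t)-(I-R^T)(\sum_\pi s_\pi(t)\pi-y(t))$; $a(t)=\lambda t$; $\sum_\pi s_\pi(t)=t$; $y(t)\le\sum_\pi s_\pi(t)\pi$; each $s_\pi$ and $y_n$ nondecreasing; at every time $t$ where they are differentiable, $\dot y_n(t)=0$ if $q_n(t)>0$, and $\dot s_\pi(t)=0$ if $\pi\cdot(I-R)f(q(t))<\max_{\rho\in\mathcal S}\rho\cdot(I-R)f(q(t))$. $\mathrm{FMS}$ is the set of these; $\mathrm{FMS}_K=\{x\in\mathrm{FMS}:|q(0)|\le K\}$; $\mathrm{FMS}(q_0)=\{x\in\mathrm{FMS}:q(0)=q_0\}$. *)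

theory Defs
  imports "HOL-Analysis.Analysis" "HOL-Library.Countable"
begin

definition maxnorm :: "real^'n::finite \<Rightarrow> real" where
  "maxnorm v = Max (range (\<lambda>i. \<bar>v $ i\<bar>))"

definition nonneg_vec :: "real^'n::finite \<Rightarrow> bool" where
  "nonneg_vec v \<longleftrightarrow> (\<forall>i. 0 \<le> v $ i)"

definition fvec :: "(real \<Rightarrow> real) \<Rightarrow> real^'n \<Rightarrow> real^'n" where
  "fvec f v = (\<chi> i. f (v $ i))"

definition ident :: "real^'n^'n" where "ident = mat 1"

definition mw_weight :: "real^'n::finite^'n \<Rightarrow> (real \<Rightarrow> real) \<Rightarrow> real^'n \<Rightarrow> real^'n \<Rightarrow> real" where
  "mw_weight R f q \<pi> = \<pi> \<bullet> ((ident - R) *v fvec f q)"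

definition is_max_weight :: "(real^'n::finite) set \<Rightarrow> real^'n^'n \<Rightarrow> (real \<Rightarrow> real) \<Rightarrow> real^'n \<Rightarrow> real^'n \<Rightarrow> bool" where
  "is_max_weight Sch R f q \<pi> \<longleftrightarrow> \<pi> \<in> Sch \<and> (\<forall>\<rho>\<in>Sch. mw_weight R f q \<rho> \<le> mw_weight R f q \<pi>)"

definition network_data :: "(real^'n::finite) set \<Rightarrow> real^'n^'n \<Rightarrow> (real \<Rightarrow> real) \<Rightarrow> bool" where
  "network_data Sch R f \<longleftrightarrow>
     finite Sch \<and> Sch \<noteq> {} \<and> (\<forall>\<pi>\<in>Sch. nonneg_vec \<pi>) \<and>
     (\<forall>i j. R $ i $ j = 0 \<or> R $ i $ j = 1) \<and>
     (\<forall>i j k. R $ i $ j = 1 \<and> R $ i $ k = 1 \<longrightarrow> j = k) \<and>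
     acyclic {(i, j). R $ i $ j = 1} \<and>
     (\<forall>x\<ge>0. f differentiable (at x within {0..})) \<and>
     strict_mono_on {0..} f \<and> f 0 = 0 \<and> (\<forall>x\<ge>0. 0 \<le> f x) \<and>
     (\<forall>q \<pi> \<kappa>. nonneg_vec q \<and> is_max_weight Sch R f q \<pi> \<and> 0 \<le> \<kappa> \<longrightarrow>
                 is_max_weight Sch R f (\<kappa> *\<^sub>R q) \<pi>) \<and>
     (R \<noteq> 0 \<longrightarrow> (\<forall>\<pi>\<in>Sch. \<forall>\<rho>. (\<forall>n. \<rho> $ n = 0 \<or> \<rho> $ n = \<pi> $ n) \<longrightarrow> \<rho> \<in> Sch))"

text \<open>Sample paths (Q, A, Y, S) in discrete time under the MW-f policy.
  sigma tau = dB(tau) is the schedule used in slot tau; B(tau) = sum of sigma over slots before tau.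
  S pi tau counts the slots before tau using schedule pi.\<close>
definition mw_sample_path ::
  "(real^'n::finite) set \<Rightarrow> real^'n^'n \<Rightarrow> (real \<Rightarrow> real) \<Rightarrow>
   (nat \<Rightarrow> real^'n) \<Rightarrow> (nat \<Rightarrow> real^'n) \<Rightarrow> (nat \<Rightarrow> real^'n) \<Rightarrow> (real^'n \<Rightarrow> nat \<Rightarrow> real) \<Rightarrow> bool" where
  "mw_sample_path Sch R f Q A Y S \<longleftrightarrow>
     (\<exists>\<sigma> :: nat \<Rightarrow> real^'n.
        (\<forall>\<tau>. \<sigma> \<tau> \<in> Sch) \<and>
        nonneg_vec (Q 0) \<and>
        A 0 = 0 \<and> (\<forall>\<tau> i. A \<tau> $ i \<le> A (Suc \<tau>) $ i) \<and>
        Y 0 = 0 \<and> (\<forall>\<tau>. Y (Suc \<tau>) - Y \<tau> = (\<chi> i. max 0 (\<sigma> \<tau> $ i - Q \<tau> $ i))) \<and>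
        (\<forall>\<pi> \<tau>. S \<pi> \<tau> = real (card {\<tau>'. \<tau>' < \<tau> \<and> \<sigma> \<tau>' = \<pi>})) \<and>
        (\<forall>\<tau>. Q \<tau> = Q 0 + A \<tau> - (ident - transpose R) *v ((\<Sum>\<tau>'<\<tau>. \<sigma> \<tau>') - Y \<tau>)) \<and>
        (\<forall>\<tau>. is_max_weight Sch R f (Q \<tau>) (\<sigma> \<tau>)))"

definition interp :: "(nat \<Rightarrow> 'a::real_vector) \<Rightarrow> real \<Rightarrow> 'a" where
  "interp F t = F (nat \<lfloor>t\<rfloor>) + (t - of_int \<lfloor>t\<rfloor>) *\<^sub>R (F (Suc (nat \<lfloor>t\<rfloor>)) - F (nat \<lfloor>t\<rfloor>))"

text \<open>Continuous-time paths x = (q, a, y, s); s is indexed by schedules.\<close>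
type_synonym 'n cpath = "(real \<Rightarrow> real^'n) \<times> (real \<Rightarrow> real^'n) \<times> (real \<Rightarrow> real^'n) \<times> (real^'n \<Rightarrow> real \<Rightarrow> real)"

definition fluid_scale ::
  "real \<Rightarrow> (nat \<Rightarrow> real^'n) \<Rightarrow> (nat \<Rightarrow> real^'n) \<Rightarrow> (nat \<Rightarrow> real^'n) \<Rightarrow> (real^'n \<Rightarrow> nat \<Rightarrow> real) \<Rightarrow> 'n cpath" where
  "fluid_scale z Q A Y S =
     ((\<lambda>t. (1 / z) *\<^sub>R interp Q (z * t)), (\<lambda>t. (1 / z) *\<^sub>R interp A (z * t)),
      (\<lambda>t. (1 / z) *\<^sub>R interp Y (z * t)), (\<lambda>\<pi> t. interp (S \<pi>) (z * t) / z))"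

definition pdist :: "(real^'n::finite) set \<Rightarrow> real \<Rightarrow> 'n cpath \<Rightarrow> 'n cpath \<Rightarrow> real" where
  "pdist Sch T x x' = (case x of (q, a, y, s) \<Rightarrow> case x' of (q', a', y', s') \<Rightarrow>
     (SUP t\<in>{0..T}. max (maxnorm (q t - q' t)) (max (maxnorm (a t - a' t))
        (max (maxnorm (y t - y' t)) (Max (insert 0 ((\<lambda>\<pi>. \<bar>s \<pi> t - s' \<pi> t\<bar>) ` Sch)))))))"

text \<open>d(g, E) = inf over h in E of d(g, h) (infinite if E is empty).\<close>
definition pdist_set :: "(real^'n::finite) set \<Rightarrow> real \<Rightarrow> 'n cpath \<Rightarrow> 'n cpath set \<Rightarrow> ereal" where
  "pdist_set Sch T x E = (INF h\<in>E. ereal (pdist Sch T x h))"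

definition abs_continuous_on :: "real \<Rightarrow> real \<Rightarrow> (real \<Rightarrow> real) \<Rightarrow> bool" where
  "abs_continuous_on a b g \<longleftrightarrow>
     (\<forall>e>0. \<exists>d>0. \<forall>(n::nat) (u::nat \<Rightarrow> real) v.
        (\<forall>i<n. a \<le> u i \<and> u i \<le> v i \<and> v i \<le> b) \<and>
        (\<forall>i<n. \<forall>k<n. i \<noteq> k \<longrightarrow> v i \<le> u k \<or> v k \<le> u i) \<and>
        (\<Sum>i<n. v i - u i) < d \<longrightarrow> (\<Sum>i<n. \<bar>g (v i) - g (u i)\<bar>) < e)"

definition FMS :: "(real^'n::finite) set \<Rightarrow> real^'n^'n \<Rightarrow> (real \<Rightarrow> real) \<Rightarrow> real \<Rightarrow> real^'n \<Rightarrow> 'n cpath set" where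
  "FMS Sch R f T lam = {(q, a, y, s).
     (\<forall>t\<in>{0..T}. nonneg_vec (q t) \<and> nonneg_vec (a t) \<and> nonneg_vec (y t)) \<and>
     (\<forall>\<pi>\<in>Sch. \<forall>t\<in>{0..T}. 0 \<le> s \<pi> t) \<and>
     (\<forall>i. abs_continuous_on 0 T (\<lambda>t. q t $ i) \<and> abs_continuous_on 0 T (\<lambda>t. a t $ i)
          \<and> abs_continuous_on 0 T (\<lambda>t. y t $ i)) \<and>
     (\<forall>\<pi>\<in>Sch. abs_continuous_on 0 T (s \<pi>)) \<and>
     (\<forall>t\<in>{0..T}. q t = q 0 + a t - (ident - transpose R) *v ((\<Sum>\<pi>\<in>Sch. s \<pi> t *\<^sub>R \<pi>) - y t)) \<and>
     (\<forall>t\<in>{0..T}. a t = t *\<^sub>R lam) \<and>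
     (\<forall>t\<in>{0..T}. (\<Sum>\<pi>\<in>Sch. s \<pi> t) = t) \<and>
     (\<forall>t\<in>{0..T}. \<forall>i. y t $ i \<le> (\<Sum>\<pi>\<in>Sch. s \<pi> t *\<^sub>R \<pi>) $ i) \<and>
     (\<forall>\<pi>\<in>Sch. mono_on {0..T} (s \<pi>)) \<and>
     (\<forall>i. mono_on {0..T} (\<lambda>t. y t $ i)) \<and>
     (\<forall>t\<in>{0<..<T}. \<forall>i D. ((\<lambda>u. y u $ i) has_real_derivative D) (at t) \<and> 0 < q t $ i \<longrightarrow> D = 0) \<and>
     (\<forall>t\<in>{0<..<T}. \<forall>\<pi>\<in>Sch. \<forall>D. (s \<pi> has_real_derivative D) (at t) \<and>
          \<not> is_max_weight Sch R f (q t) \<pi> \<longrightarrow> D = 0)}"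

definition FMS_K :: "(real^'n::finite) set \<Rightarrow> real^'n^'n \<Rightarrow> (real \<Rightarrow> real) \<Rightarrow> real \<Rightarrow> real^'n \<Rightarrow> real \<Rightarrow> 'n cpath set" where
  "FMS_K Sch R f T lam K = {x \<in> FMS Sch R f T lam. maxnorm (fst x 0) \<le> K}"

definition FMS_q0 :: "(real^'n::finite) set \<Rightarrow> real^'n^'n \<Rightarrow> (real \<Rightarrow> real) \<Rightarrow> real \<Rightarrow> real^'n \<Rightarrow> real^'n \<Rightarrow> 'n cpath set" where
  "FMS_q0 Sch R f T lam q0 = {x \<in> FMS Sch R f T lam. fst x 0 = q0}"

definition fluid_scaled_paths :: "(real^'n::finite) set \<Rightarrow> real^'n^'n \<Rightarrow> (real \<Rightarrow> real) \<Rightarrow> ('n cpath \<times> real) set" where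
  "fluid_scaled_paths Sch R f = {(fluid_scale z Q A Y S, z) | z Q A Y S.
      1 \<le> z \<and> mw_sample_path Sch R f Q A Y S}"

end

theory Submission
  imports Defs "HOL-Complex_Analysis.Great_Picard"
begin

text \<open>The schedule counts and idling processes of fluid-scaled paths are uniformly Lipschitz, and the
  queue process is an affine image of them, of the arrivals and of the initial state. So by
  Arzela-Ascoli every sequence of scaled paths with \<open>z \<rightarrow> \<infinity>\<close> has a uniformly convergent subsequence.
  Its limit is a fluid model solution: where \<open>q\<^sub>n(t) > 0\<close>, the unscaled queue exceeds every schedule
  near \<open>zt\<close>, so no idling occurs; where \<open>\<pi>\<close> is not of maximal weight at \<open>q(t)\<close>, by continuity of \<open>f\<close>
  and scale invariance it is not scheduled near \<open>zt\<close>. In both cases the prelimit component is constant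
  around \<open>t\<close>, hence so is its limit. If the distance to the fluid model solutions did not tend to \<open>0\<close>
  uniformly, a sequence of bad paths would contradict this.\<close>

subsection \<open>Piecewise linear interpolation\<close>

text \<open>Share of slot \<open>n\<close> that lies before time \<open>t\<close>.\<close>

definition ramp :: "real \<Rightarrow> nat \<Rightarrow> real" where
  "ramp t n = max 0 (min 1 (t - real n))"

lemma ramp_mono: "s \<le> t \<Longrightarrow> ramp s n \<le> ramp t n"
  by (auto simp: ramp_def)

text \<open>Identifies the slots \<open>[n, n + 1)\<close> that overlap the time interval; only
  these contribute to an increment of an interpolated process.\<close>

lemma ramp_neqD:
  assumes "s \<le> t" "ramp s n \<noteq> ramp t n"
  shows "real n < t" "s < real n + 1"
  using assms by (auto simp: ramp_def max_def min_def split: if_splits)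

text \<open>Slots before the current one carry weight 1, the current one the elapsed fraction, later
  ones 0, so the full slots telescope. The range \<open>n<N\<close> does not depend on
  \<open>t\<close>, so values at two times can be subtracted term by term.\<close>

lemma interp_telescope:
  assumes t: "0 \<le> t" "t < real N"
  shows "interp F t = F 0 + (\<Sum>n<N. ramp t n *\<^sub>R (F (Suc n) - F n))"
proof -
  define m where "m = nat \<lfloor>t\<rfloor>"
  have m: "real m \<le> t" "t < real m + 1" and fl: "\<lfloor>t\<rfloor> = int m"
    using t by (auto simp: m_def of_nat_nat)
  have "m < N" using m t by linarith
  have "(\<Sum>n<N. ramp t n *\<^sub>R (F (Suc n) - F n))
      = (\<Sum>n<Suc m. ramp t n *\<^sub>R (F (Suc n) - F n)) + (\<Sum>n=Suc m..<N. ramp t n *\<^sub>R (F (Suc n) - F n))"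
    unfolding lessThan_atLeast0 using \<open>m < N\<close> by (intro sum.atLeastLessThan_concat[symmetric]) auto
  also have "(\<Sum>n=Suc m..<N. ramp t n *\<^sub>R (F (Suc n) - F n)) = 0"
    using m by (intro sum.neutral) (auto simp: ramp_def)
  also have "(\<Sum>n<m. ramp t n *\<^sub>R (F (Suc n) - F n)) = (\<Sum>n<m. F (Suc n) - F n)"
    using m by (intro sum.cong) (auto simp: ramp_def)
  then have "(\<Sum>n<Suc m. ramp t n *\<^sub>R (F (Suc n) - F n)) = F m - F 0 + (t - m) *\<^sub>R (F (Suc m) - F m)"
    using m by (simp add: sum_lessThan_telescope ramp_def)
  finally show ?thesis
    by (simp add: interp_def fl)
qed

lemma interp_of_nat_fun: "0 \<le> t \<Longrightarrow> interp real t = t"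
  by (simp add: interp_def)

lemma interp_of_nat [simp]: "interp F (real n) = F n"
  by (simp add: interp_def)

lemma interp_0 [simp]: "interp F 0 = F 0"
  using interp_of_nat[of F 0] by simp

lemma sum_ramp: "0 \<le> t \<Longrightarrow> t < real N \<Longrightarrow> (\<Sum>n<N. ramp t n) = t"
  using interp_telescope[of t N real] by (simp add: interp_of_nat_fun)

lemma interp_increment:
  assumes "0 \<le> s" "s \<le> t" "t < real N"
  shows "interp F t - interp F s = (\<Sum>n<N. (ramp t n - ramp s n) *\<^sub>R (F (Suc n) - F n))"
  using assms by (simp add: interp_telescope[of _ N] scaleR_left_diff_distrib sum_subtractf)

text \<open>The increment is a weighted sum of one-slot increments; the weights are nonnegative by
  monotonicity of \<open>ramp\<close> and add up to \<open>t - s\<close> by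
  \<open>sum_ramp\<close>.\<close>

lemma interp_increment_bounds:
  fixes F :: "nat \<Rightarrow> real"
  assumes F: "\<And>n. l \<le> F (Suc n) - F n" "\<And>n. F (Suc n) - F n \<le> L" and st: "0 \<le> s" "s \<le> t"
  shows "l * (t - s) \<le> interp F t - interp F s" "interp F t - interp F s \<le> L * (t - s)"
proof -
  obtain N where N: "t < real N" using reals_Archimedean2 by blast
  have w: "(\<Sum>n<N. ramp t n - ramp s n) = t - s"
    using st N by (simp add: sum_subtractf sum_ramp)
  have eq: "interp F t - interp F s = (\<Sum>n<N. (ramp t n - ramp s n) * (F (Suc n) - F n))"
    using interp_increment[OF st N, of F] by simp
  have "l * (t - s) = (\<Sum>n<N. (ramp t n - ramp s n) * l)"
    by (simp add: w flip: sum_distrib_right)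
  also have "\<dots> \<le> interp F t - interp F s"
    unfolding eq using F ramp_mono[OF st(2)] by (intro sum_mono mult_left_mono) auto
  finally show "l * (t - s) \<le> interp F t - interp F s" .
  have "interp F t - interp F s \<le> (\<Sum>n<N. (ramp t n - ramp s n) * L)"
    unfolding eq using F ramp_mono[OF st(2)] by (intro sum_mono mult_left_mono) auto
  also have "\<dots> = L * (t - s)"
    by (simp add: w flip: sum_distrib_right)
  finally show "interp F t - interp F s \<le> L * (t - s)" .
qed

text \<open>Every slot either has weight 0 in the increment or meets the interval, where the step of
  \<open>F\<close> vanishes. This carries a statement about discrete slots over to an interval of
  real time.\<close>

lemma interp_eqI:
  assumes "0 \<le> s" "s \<le> t" and F: "\<And>n. real n < t \<Longrightarrow> s < real n + 1 \<Longrightarrow> F (Suc n) = F n"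
  shows "interp F t = interp F s"
proof -
  obtain N where N: "t < real N" using reals_Archimedean2 by blast
  have "(ramp t n - ramp s n) *\<^sub>R (F (Suc n) - F n) = 0" for n
    using ramp_neqD[OF assms(2), of n] F[of n] by (cases "ramp s n = ramp t n") auto
  then have "interp F t - interp F s = 0"
    unfolding interp_increment[OF assms(1,2) N] by (intro sum.neutral) blast
  then show ?thesis by simp
qed

lemma interp_linear: "linear L \<Longrightarrow> L (interp F t) = interp (\<lambda>n. L (F n)) t"
  by (simp add: interp_def linear_add linear_scale linear_diff)

lemma interp_nth: "interp F t $ i = interp (\<lambda>n. F n $ i) t"
  by (simp add: interp_def)

lemma interp_add: "interp (\<lambda>n. F n + G n) t = interp F t + interp G t"
  by (simp add: interp_def algebra_simps)

lemma interp_diff: "interp (\<lambda>n. F n - G n) t = interp F t - interp G t"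
  by (simp add: interp_def algebra_simps)

lemma interp_const [simp]: "interp (\<lambda>n. c) t = c"
  by (simp add: interp_def)

lemma interp_scaleR_left: "interp (\<lambda>n. F n *\<^sub>R v) t = interp F t *\<^sub>R v"
  by (simp add: interp_def algebra_simps)

lemma interp_sum: "interp (\<lambda>n. \<Sum>p\<in>P. F p n) t = (\<Sum>p\<in>P. interp (F p) t)"
  by (simp add: interp_def sum.distrib scaleR_sum_right flip: sum_subtractf)

text \<open>Interpolation is a convex combination of two successive values, hence preserves
  inequalities between sequences.\<close>

lemma interp_mono:
  fixes F G :: "nat \<Rightarrow> real"
  assumes "\<And>n. F n \<le> G n"
  shows "interp F t \<le> interp G t"
proof -
  define H where "H n = G n - F n" for n
  define c m where "c = t - of_int \<lfloor>t\<rfloor>" and "m = nat \<lfloor>t\<rfloor>"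
  have "0 \<le> c" "c \<le> 1" unfolding c_def by linarith+
  then have "0 \<le> (1 - c) * H m + c * H (Suc m)"
    using assms by (auto simp: H_def)
  also have "\<dots> = interp H t"
    by (simp add: interp_def c_def m_def algebra_simps)
  finally show ?thesis
    by (simp add: H_def[abs_def] interp_diff)
qed

subsection \<open>Norms and Lipschitz functions\<close>

lemma component_le_maxnorm: "\<bar>v $ i\<bar> \<le> maxnorm v"
  by (auto simp: maxnorm_def)

lemma maxnorm_le_iff: "maxnorm v \<le> c \<longleftrightarrow> (\<forall>i. \<bar>v $ i\<bar> \<le> c)"
  by (auto simp: maxnorm_def)

lemma maxnorm_le_norm: "maxnorm v \<le> norm v"
  by (simp add: maxnorm_le_iff component_le_norm_cart)

lemma norm_le_if_components_le:
  fixes v :: "real^'n::finite"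
  assumes "\<And>i. \<bar>v $ i\<bar> \<le> c"
  shows "norm v \<le> real CARD('n) * c"
  using norm_le_l1_cart[of v] sum_mono[of UNIV "\<lambda>i. \<bar>v $ i\<bar>" "\<lambda>_. c"] assms by simp

lemma norm_le_maxnorm: "norm (v :: real^'n::finite) \<le> real CARD('n) * maxnorm v"
  by (rule norm_le_if_components_le) (rule component_le_maxnorm)

lemma lipschitz_on_imp_abs_continuous_on:
  fixes g :: "real \<Rightarrow> real"
  assumes "L-lipschitz_on {a..b} g"
  shows "abs_continuous_on a b g"
  unfolding abs_continuous_on_def
proof (intro allI impI)
  fix e :: real assume "0 < e"
  have L: "0 \<le> L" using assms by (rule lipschitz_on_nonneg)
  show "\<exists>d>0. \<forall>(n::nat) u v.
        (\<forall>i<n. a \<le> u i \<and> u i \<le> v i \<and> v i \<le> b) \<and>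
        (\<forall>i<n. \<forall>k<n. i \<noteq> k \<longrightarrow> v i \<le> u k \<or> v k \<le> u i) \<and>
        (\<Sum>i<n. v i - u i) < d \<longrightarrow> (\<Sum>i<n. \<bar>g (v i) - g (u i)\<bar>) < e"
  \<comment> \<open>The denominator \<open>L + 1\<close> is positive even if \<open>L = 0\<close>,
    and makes the final bound strict.\<close>
  proof (intro exI[of _ "e / (L + 1)"] conjI allI impI; (elim conjE)?)
    fix n :: nat and u v :: "nat \<Rightarrow> real"
    assume uv: "\<forall>i<n. a \<le> u i \<and> u i \<le> v i \<and> v i \<le> b" and d: "(\<Sum>i<n. v i - u i) < e / (L + 1)"
    have "(\<Sum>i<n. \<bar>g (v i) - g (u i)\<bar>) \<le> (\<Sum>i<n. L * (v i - u i))"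
    proof (rule sum_mono)
      fix i assume "i \<in> {..<n}"
      then have "u i \<in> {a..b}" "v i \<in> {a..b}" "u i \<le> v i" using uv by (auto intro: order_trans)
      then show "\<bar>g (v i) - g (u i)\<bar> \<le> L * (v i - u i)"
        using lipschitz_onD[OF assms, of "v i" "u i"] by (simp add: dist_real_def)
    qed
    also have "\<dots> = L * (\<Sum>i<n. v i - u i)"
      by (simp add: sum_distrib_left)
    also have "\<dots> \<le> L * (e / (L + 1))"
      using d L by (intro mult_left_mono) auto
    also have "\<dots> < e"
      using \<open>0 < e\<close> L by (simp add: field_simps)
    finally show "(\<Sum>i<n. \<bar>g (v i) - g (u i)\<bar>) < e" .
  qed (use \<open>0 < e\<close> L in auto)
qed

text \<open>Monotonicity and the increment bound are non-strict inequalities between values at two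
  points, so pointwise convergence preserves them.\<close>

lemma Lipschitz_limit:
  fixes g :: "nat \<Rightarrow> real \<Rightarrow> real"
  assumes lim: "\<And>t. t \<in> X \<Longrightarrow> (\<lambda>k. g k t) \<longlonglongrightarrow> h t" and "0 \<le> L"
    and g: "\<And>k u t. u \<in> X \<Longrightarrow> t \<in> X \<Longrightarrow> u \<le> t \<Longrightarrow> g k u \<le> g k t \<and> g k t - g k u \<le> L * (t - u)"
  shows "mono_on X h" "L-lipschitz_on X h"
proof -
  have *: "h u \<le> h t" "h t - h u \<le> L * (t - u)" if "u \<in> X" "t \<in> X" "u \<le> t" for u t
    using that g[OF that]
    by (auto intro: LIMSEQ_le[OF lim lim] LIMSEQ_le_const2[OF tendsto_diff[OF lim lim]])
  then show "mono_on X h" by (auto intro: mono_onI)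
  show "L-lipschitz_on X h"
  proof (rule lipschitz_onI[OF _ \<open>0 \<le> L\<close>])
    fix t u assume "t \<in> X" "u \<in> X"
    then show "dist (h t) (h u) \<le> L * dist t u"
      using *[of u t] *[of t u] by (cases "u \<le> t") (auto simp: dist_real_def)
  qed
qed

subsection \<open>Fluid-scaled sample paths\<close>

lemma ident_minus_transpose_mult_nth:
  "((ident - transpose R) *v v) $ i = v $ i - (\<Sum>j\<in>UNIV. R $ j $ i * v $ j)"
  by (simp add: ident_def matrix_vector_mult_diff_rdistrib matrix_vector_mult_def transpose_def mat_def
      sum_subtractf of_bool_def left_diff_distrib if_distrib[of "\<lambda>x. x * _"] cong: if_cong)

text \<open>Interface to the sample path definition: cumulative service is expressed through the
  counts \<open>S\<close>, as in the fluid model, and the dynamics through increments per slot. Two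
  facts are derived here by induction: queues stay nonnegative, and idling never exceeds offered
  service.\<close>

lemma mw_sample_path_slots:
  fixes Sch :: "(real^'n::finite) set"
  assumes net: "network_data Sch R f" and path: "mw_sample_path Sch R f Q A Y S"
  obtains \<sigma> where
    "\<And>\<tau>. is_max_weight Sch R f (Q \<tau>) (\<sigma> \<tau>)"
    "\<And>\<tau>. nonneg_vec (Q \<tau>)"
    "Y 0 = 0" "\<And>\<tau> i. Y (Suc \<tau>) $ i - Y \<tau> $ i = max 0 (\<sigma> \<tau> $ i - Q \<tau> $ i)"
    "\<And>\<pi>. S \<pi> 0 = 0" "\<And>\<pi> \<tau>. S \<pi> (Suc \<tau>) - S \<pi> \<tau> = of_bool (\<sigma> \<tau> = \<pi>)"
    "\<And>\<tau>. (\<Sum>\<pi>\<in>Sch. S \<pi> \<tau>) = real \<tau>"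
    "\<And>\<tau>. Q \<tau> = Q 0 + A \<tau> - (ident - transpose R) *v ((\<Sum>\<pi>\<in>Sch. S \<pi> \<tau> *\<^sub>R \<pi>) - Y \<tau>)"
    "\<And>\<tau> i. Y \<tau> $ i \<le> (\<Sum>\<pi>\<in>Sch. S \<pi> \<tau> *\<^sub>R \<pi>) $ i"
proof -
  have Sch: "finite Sch" "\<And>\<pi> i. \<pi> \<in> Sch \<Longrightarrow> 0 \<le> \<pi> $ i"
    using net by (auto simp: network_data_def nonneg_vec_def)
  have "R $ i $ j = 0 \<or> R $ i $ j = 1" for i j
    using net unfolding network_data_def by blast
  then have R01: "0 \<le> R $ i $ j" for i j
    by (metis order_refl zero_le_one)
  obtain \<sigma> where \<sigma>: "\<And>\<tau>. \<sigma> \<tau> \<in> Sch" and Q0: "nonneg_vec (Q 0)" and A0: "A 0 = 0"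
    and A: "\<And>\<tau> i. A \<tau> $ i \<le> A (Suc \<tau>) $ i"
    and Y0: "Y 0 = 0" and Y: "\<And>\<tau>. Y (Suc \<tau>) - Y \<tau> = (\<chi> i. max 0 (\<sigma> \<tau> $ i - Q \<tau> $ i))"
    and S: "\<And>\<pi> \<tau>. S \<pi> \<tau> = real (card {\<tau>'. \<tau>' < \<tau> \<and> \<sigma> \<tau>' = \<pi>})"
    and Q: "\<And>\<tau>. Q \<tau> = Q 0 + A \<tau> - (ident - transpose R) *v ((\<Sum>\<tau>'<\<tau>. \<sigma> \<tau>') - Y \<tau>)"
    and mw: "\<And>\<tau>. is_max_weight Sch R f (Q \<tau>) (\<sigma> \<tau>)"
    using path unfolding mw_sample_path_def by blast
  have dY: "Y (Suc \<tau>) $ i - Y \<tau> $ i = max 0 (\<sigma> \<tau> $ i - Q \<tau> $ i)" for \<tau> i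
    using arg_cong[OF Y[of \<tau>], of "\<lambda>v. v $ i"] by simp
  have S0: "S \<pi> 0 = 0" for \<pi> by (simp add: S)
  have dS: "S \<pi> (Suc \<tau>) - S \<pi> \<tau> = of_bool (\<sigma> \<tau> = \<pi>)" for \<pi> \<tau>
  proof -
    have "{\<tau>'. \<tau>' < Suc \<tau> \<and> \<sigma> \<tau>' = \<pi>} =
        (if \<sigma> \<tau> = \<pi> then insert \<tau> {\<tau>'. \<tau>' < \<tau> \<and> \<sigma> \<tau>' = \<pi>} else {\<tau>'. \<tau>' < \<tau> \<and> \<sigma> \<tau>' = \<pi>})"
      by (auto simp: less_Suc_eq)
    then show ?thesis by (simp add: S)
  qed
  have Ssuc: "S \<pi> (Suc \<tau>) = S \<pi> \<tau> + of_bool (\<sigma> \<tau> = \<pi>)" for \<pi> \<tau>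
    using dS[of \<pi> \<tau>] by simp
  have sumS: "(\<Sum>\<pi>\<in>Sch. S \<pi> \<tau>) = real \<tau>" for \<tau>
    by (induction \<tau>) (use Sch \<sigma> in \<open>simp_all add: S0 Ssuc sum.distrib of_bool_def\<close>)
  have B: "(\<Sum>\<pi>\<in>Sch. S \<pi> \<tau> *\<^sub>R \<pi>) = (\<Sum>\<tau>'<\<tau>. \<sigma> \<tau>')" for \<tau>
    by (induction \<tau>)
      (use Sch \<sigma> in \<open>simp_all add: S0 Ssuc scaleR_left_distrib sum.distrib of_bool_def
        if_distrib[of "\<lambda>x. x *\<^sub>R _"] cong: if_cong\<close>)
  \<comment> \<open>One-slot queue recursion: offered service minus idling is the actual departure
    \<open>min \<sigma> Q\<close>, which leaves queue \<open>i\<close> and is routed along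
    \<open>R\<close>. No queue loses more than its content.\<close>
  have Q_Suc: "Q (Suc \<tau>) $ i = Q \<tau> $ i + (A (Suc \<tau>) $ i - A \<tau> $ i) - min (\<sigma> \<tau> $ i) (Q \<tau> $ i)
      + (\<Sum>j\<in>UNIV. R $ j $ i * min (\<sigma> \<tau> $ j) (Q \<tau> $ j))" for \<tau> i
  proof -
    have m: "\<sigma> \<tau> $ j - (Y (Suc \<tau>) $ j - Y \<tau> $ j) = min (\<sigma> \<tau> $ j) (Q \<tau> $ j)" for j
      unfolding dY by linarith
    let ?M = "ident - transpose R"
    have "Q (Suc \<tau>) = Q \<tau> + (A (Suc \<tau>) - A \<tau>) - ?M *v (\<sigma> \<tau> - (Y (Suc \<tau>) - Y \<tau>))"
      by (subst Q[of "Suc \<tau>"], subst Q[of \<tau>])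
        (simp add: matrix_vector_mult_diff_distrib matrix_vector_right_distrib algebra_simps)
    then show ?thesis
      by (simp add: ident_minus_transpose_mult_nth m)
  qed
  have Qpos: "nonneg_vec (Q \<tau>)" for \<tau>
  proof (induction \<tau>)
    case (Suc \<tau>)
    have "0 \<le> (\<Sum>j\<in>UNIV. R $ j $ i * min (\<sigma> \<tau> $ j) (Q \<tau> $ j))" for i
      using Suc Sch(2)[OF \<sigma>] R01 by (intro sum_nonneg mult_nonneg_nonneg) (auto simp: nonneg_vec_def)
    with A[of \<tau>] show ?case
      unfolding nonneg_vec_def Q_Suc by (smt (verit))
  qed (fact Q0)
  \<comment> \<open>As \<open>Q\<close> and \<open>\<sigma>\<close> are nonnegative, the idling
    \<open>max 0 (\<sigma> - Q)\<close> of a slot is at most \<open>\<sigma>\<close>.\<close>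
  have YB: "Y \<tau> $ i \<le> (\<Sum>\<tau>'<\<tau>. \<sigma> \<tau>') $ i" for \<tau> i
  proof (induction \<tau>)
    case (Suc \<tau>)
    have "0 \<le> Q \<tau> $ i" "0 \<le> \<sigma> \<tau> $ i"
      using Qpos Sch(2)[OF \<sigma>] by (auto simp: nonneg_vec_def)
    then show ?case using Suc dY[of \<tau> i] by simp
  qed (simp add: Y0)
  show thesis
    by (rule that[of \<sigma>, unfolded B]) (rule mw Qpos Y0 dY S0 dS sumS Q YB)+
qed

lemma schedules_bounded:
  assumes "network_data Sch R f"
  obtains C where "0 \<le> C" "\<And>\<pi> i. \<pi> \<in> Sch \<Longrightarrow> \<pi> $ i \<le> C"
proof
  have fin: "finite Sch" using assms by (simp add: network_data_def)
  show "0 \<le> (\<Sum>\<pi>\<in>Sch. norm \<pi>)" by (simp add: sum_nonneg)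
  fix \<pi> i assume "\<pi> \<in> Sch"
  have "\<pi> $ i \<le> norm \<pi>"
    using component_le_norm_cart[of \<pi> i] by simp
  also have "\<dots> \<le> (\<Sum>\<pi>\<in>Sch. norm \<pi>)"
    using fin \<open>\<pi> \<in> Sch\<close> by (simp add: member_le_sum)
  finally show "\<pi> $ i \<le> (\<Sum>\<pi>\<in>Sch. norm \<pi>)" .
qed

section \<open>Properties of a single fluid-scaled path\<close>

context
  fixes Sch :: "(real^'n::finite) set" and R :: "real^'n^'n" and f :: "real \<Rightarrow> real"
    and q a y :: "real \<Rightarrow> real^'n" and s :: "real^'n \<Rightarrow> real \<Rightarrow> real" and z :: real
  assumes net: "network_data Sch R f"
    and scaled: "((q, a, y, s), z) \<in> fluid_scaled_paths Sch R f"
begin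

lemma fluid_scaled_path_cases:
  obtains Q A Y S where "1 \<le> z" "mw_sample_path Sch R f Q A Y S"
    "\<And>t. q t = (1 / z) *\<^sub>R interp Q (z * t)" "\<And>t. a t = (1 / z) *\<^sub>R interp A (z * t)"
    "\<And>t. y t = (1 / z) *\<^sub>R interp Y (z * t)" "\<And>\<pi> t. s \<pi> t = interp (S \<pi>) (z * t) / z"
  using scaled by (auto simp: fluid_scaled_paths_def fluid_scale_def)

lemma fluid_scaled_path_z: "1 \<le> z"
  by (rule fluid_scaled_path_cases)

lemma fluid_scaled_path_initial: "y 0 = 0" "s \<pi> 0 = 0"
proof -
  obtain Q A Y S where path: "mw_sample_path Sch R f Q A Y S" and
    eq: "y 0 = (1 / z) *\<^sub>R interp Y (z * 0)" "s \<pi> 0 = interp (S \<pi>) (z * 0) / z"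
    by (rule fluid_scaled_path_cases) (rule that; simp only:)
  have "Y 0 = 0" "S \<pi> 0 = 0"
    by (rule mw_sample_path_slots[OF net path]; assumption)+
  then show "y 0 = 0" "s \<pi> 0 = 0"
    by (simp_all add: eq)
qed

text \<open>Interpolation and scaling are linear, so the discrete identities carry over to real
  time; the inequalities carry over because interpolation is also monotone.\<close>

lemma fluid_scaled_path_static:
  assumes t: "0 \<le> t"
  shows "nonneg_vec (q t)"
    and "q t = q 0 + a t - (ident - transpose R) *v ((\<Sum>\<pi>\<in>Sch. s \<pi> t *\<^sub>R \<pi>) - y t)"
    and "(\<Sum>\<pi>\<in>Sch. s \<pi> t) = t"
    and "y t $ i \<le> (\<Sum>\<pi>\<in>Sch. s \<pi> t *\<^sub>R \<pi>) $ i"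
proof -
  obtain Q A Y S where z: "1 \<le> z" and path: "mw_sample_path Sch R f Q A Y S" and
    eq: "\<And>t. q t = (1 / z) *\<^sub>R interp Q (z * t)" "\<And>t. a t = (1 / z) *\<^sub>R interp A (z * t)"
    "\<And>t. y t = (1 / z) *\<^sub>R interp Y (z * t)" "\<And>\<pi> t. s \<pi> t = interp (S \<pi>) (z * t) / z"
    by (rule fluid_scaled_path_cases) (rule that; assumption)
  obtain \<sigma> where Qpos: "\<And>\<tau>. nonneg_vec (Q \<tau>)" and sumS: "\<And>\<tau>. (\<Sum>\<pi>\<in>Sch. S \<pi> \<tau>) = real \<tau>"
    and Q: "\<And>\<tau>. Q \<tau> = Q 0 + A \<tau> - (ident - transpose R) *v ((\<Sum>\<pi>\<in>Sch. S \<pi> \<tau> *\<^sub>R \<pi>) - Y \<tau>)"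
    and YB: "\<And>\<tau> i. Y \<tau> $ i \<le> (\<Sum>\<pi>\<in>Sch. S \<pi> \<tau> *\<^sub>R \<pi>) $ i"
    by (rule mw_sample_path_slots[OF net path]) (rule that; assumption)
  have sB: "(\<Sum>\<pi>\<in>Sch. s \<pi> t *\<^sub>R \<pi>) = (1 / z) *\<^sub>R interp (\<lambda>\<tau>. \<Sum>\<pi>\<in>Sch. S \<pi> \<tau> *\<^sub>R \<pi>) (z * t)" for t
    by (simp add: eq interp_sum interp_scaleR_left scaleR_sum_right)
  show "nonneg_vec (q t)"
  proof -
    have "0 \<le> interp Q (z * t) $ i" for i
      using interp_mono[of "\<lambda>_. 0" "\<lambda>\<tau>. Q \<tau> $ i" "z * t"] Qpos by (simp add: interp_nth nonneg_vec_def)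
    then show ?thesis using z by (simp add: eq nonneg_vec_def)
  qed
  show "q t = q 0 + a t - (ident - transpose R) *v ((\<Sum>\<pi>\<in>Sch. s \<pi> t *\<^sub>R \<pi>) - y t)"
  proof -
    let ?M = "ident - transpose R"
    have "interp Q (z * t) = interp (\<lambda>\<tau>. Q 0 + A \<tau> - ?M *v ((\<Sum>\<pi>\<in>Sch. S \<pi> \<tau> *\<^sub>R \<pi>) - Y \<tau>)) (z * t)"
      using Q by metis
    also have "\<dots> = Q 0 + interp A (z * t) - interp (\<lambda>\<tau>. ?M *v ((\<Sum>\<pi>\<in>Sch. S \<pi> \<tau> *\<^sub>R \<pi>) - Y \<tau>)) (z * t)"
      by (simp add: interp_add interp_diff)
    also have "interp (\<lambda>\<tau>. ?M *v ((\<Sum>\<pi>\<in>Sch. S \<pi> \<tau> *\<^sub>R \<pi>) - Y \<tau>)) (z * t)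
        = ?M *v (interp (\<lambda>\<tau>. \<Sum>\<pi>\<in>Sch. S \<pi> \<tau> *\<^sub>R \<pi>) (z * t) - interp Y (z * t))"
      by (simp add: interp_linear[OF matrix_vector_mul_linear, symmetric] interp_diff)
    finally have "interp Q (z * t) = Q 0 + interp A (z * t)
        - ?M *v (interp (\<lambda>\<tau>. \<Sum>\<pi>\<in>Sch. S \<pi> \<tau> *\<^sub>R \<pi>) (z * t) - interp Y (z * t))" .
    moreover have "?M *v ((1 / z) *\<^sub>R v - (1 / z) *\<^sub>R w) = (1 / z) *\<^sub>R (?M *v (v - w))" for v w
      by (metis matrix_vector_mult_scaleR scaleR_right_diff_distrib)
    ultimately show ?thesis
      unfolding sB unfolding eq by (simp only: mult_zero_right interp_0 scaleR_right_distrib scaleR_right_diff_distrib)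
  qed
  have "(\<Sum>\<pi>\<in>Sch. interp (S \<pi>) (z * t)) = z * t"
    using t z by (simp add: sumS interp_of_nat_fun flip: interp_sum)
  then show "(\<Sum>\<pi>\<in>Sch. s \<pi> t) = t"
    using z by (simp add: eq flip: sum_divide_distrib)
  show "y t $ i \<le> (\<Sum>\<pi>\<in>Sch. s \<pi> t *\<^sub>R \<pi>) $ i"
    unfolding sB using z interp_mono[of "\<lambda>\<tau>. Y \<tau> $ i" _ "z * t", OF YB]
    by (simp add: eq interp_nth divide_right_mono)
qed

text \<open>In one slot a count grows by at most 1 and idling by at most \<open>max 0 C\<close>;
  speeding up time by \<open>z\<close> and dividing by \<open>z\<close> cancel, so the slopes do not
  depend on \<open>z\<close>. The sign of \<open>C\<close> is left open, hence the
  \<open>max\<close>.\<close>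

lemma fluid_scaled_path_increments:
  assumes C: "\<And>\<pi> i. \<pi> \<in> Sch \<Longrightarrow> \<pi> $ i \<le> C" and ut: "0 \<le> u" "u \<le> t"
  shows "y u $ i \<le> y t $ i" "y t $ i - y u $ i \<le> max 0 C * (t - u)"
    and "s \<pi> u \<le> s \<pi> t" "s \<pi> t - s \<pi> u \<le> t - u"
proof -
  obtain Q A Y S where z: "1 \<le> z" and path: "mw_sample_path Sch R f Q A Y S" and
    eq: "\<And>t. y t = (1 / z) *\<^sub>R interp Y (z * t)" "\<And>\<pi> t. s \<pi> t = interp (S \<pi>) (z * t) / z"
    by (rule fluid_scaled_path_cases) (rule that; assumption)
  obtain \<sigma> where mw: "\<And>\<tau>. is_max_weight Sch R f (Q \<tau>) (\<sigma> \<tau>)" and Qpos: "\<And>\<tau>. nonneg_vec (Q \<tau>)"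
    and dY: "\<And>\<tau> i. Y (Suc \<tau>) $ i - Y \<tau> $ i = max 0 (\<sigma> \<tau> $ i - Q \<tau> $ i)"
    and dS: "\<And>\<pi> \<tau>. S \<pi> (Suc \<tau>) - S \<pi> \<tau> = of_bool (\<sigma> \<tau> = \<pi>)"
    by (rule mw_sample_path_slots[OF net path]) (rule that; assumption)
  have zut: "0 \<le> z * u" "z * u \<le> z * t"
    using z ut by (auto intro: mult_left_mono)
  have "0 \<le> Y (Suc \<tau>) $ i - Y \<tau> $ i" "Y (Suc \<tau>) $ i - Y \<tau> $ i \<le> max 0 C" for \<tau>
    using C[of "\<sigma> \<tau>" i] mw[of \<tau>] Qpos[of \<tau>, unfolded nonneg_vec_def, rule_format, of i]
    unfolding dY is_max_weight_def by auto
  note * = interp_increment_bounds[of 0 "\<lambda>\<tau>. Y \<tau> $ i", OF this zut]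
  show "y u $ i \<le> y t $ i" "y t $ i - y u $ i \<le> max 0 C * (t - u)"
    using * z by (auto simp: eq interp_nth field_simps)
  have "0 \<le> S \<pi> (Suc \<tau>) - S \<pi> \<tau>" "S \<pi> (Suc \<tau>) - S \<pi> \<tau> \<le> 1" for \<tau>
    unfolding dS by auto
  note * = interp_increment_bounds[of 0 "S \<pi>", OF this zut]
  show "s \<pi> u \<le> s \<pi> t" "s \<pi> t - s \<pi> u \<le> t - u"
    using * z by (auto simp: eq field_simps)
qed

text \<open>A slot overlapping \<open>[z * u, z * t]\<close> may have started before
  \<open>z * u\<close>, by less than one slot. As the decision of a slot depends on the queue at its
  start, the two lemmas below impose their conditions from \<open>u - 1 / z\<close> on.\<close>

lemma slot_time:
  assumes "0 \<le> u" "real n < z * t" "z * u < real n + 1"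
  shows "0 \<le> real n / z" "u - 1 / z < real n / z" "real n / z < t"
proof -
  have "0 < z" using fluid_scaled_path_z by simp
  then show "0 \<le> real n / z" "real n / z < t"
    using assms by (auto simp: field_simps)
  have "u - 1 / z = (z * u - 1) / z"
    using \<open>0 < z\<close> by (simp add: field_simps)
  also have "\<dots> < real n / z"
    using \<open>0 < z\<close> assms by (intro divide_strict_right_mono) auto
  finally show "u - 1 / z < real n / z" .
qed

text \<open>Evaluated at the scaled start \<open>n / z\<close> of a slot, the condition says that
  the unscaled queue is at least \<open>C\<close>, hence at least the offered service, so the slot
  adds no idling.\<close>

lemma fluid_scaled_path_no_idling:
  assumes C: "\<And>\<pi> i. \<pi> \<in> Sch \<Longrightarrow> \<pi> $ i \<le> C" and ut: "0 \<le> u" "u \<le> t"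
    and busy: "\<And>v. 0 \<le> v \<Longrightarrow> u - 1 / z < v \<Longrightarrow> v < t \<Longrightarrow> C / z \<le> q v $ i"
  shows "y t $ i = y u $ i"
proof -
  obtain Q A Y S where z: "1 \<le> z" and path: "mw_sample_path Sch R f Q A Y S" and
    eq: "\<And>t. q t = (1 / z) *\<^sub>R interp Q (z * t)" "\<And>t. y t = (1 / z) *\<^sub>R interp Y (z * t)"
    by (rule fluid_scaled_path_cases) (rule that; assumption)
  obtain \<sigma> where mw: "\<And>\<tau>. is_max_weight Sch R f (Q \<tau>) (\<sigma> \<tau>)"
    and dY: "\<And>\<tau> i. Y (Suc \<tau>) $ i - Y \<tau> $ i = max 0 (\<sigma> \<tau> $ i - Q \<tau> $ i)"
    by (rule mw_sample_path_slots[OF net path]) (rule that; assumption)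
  have zut: "0 \<le> z * u" "z * u \<le> z * t"
    using z ut by (auto intro: mult_left_mono)
  have "interp (\<lambda>\<tau>. Y \<tau> $ i) (z * t) = interp (\<lambda>\<tau>. Y \<tau> $ i) (z * u)"
  proof (rule interp_eqI[OF zut])
    fix n assume "real n < z * t" "z * u < real n + 1"
    from busy[OF slot_time[OF ut(1) this]] have "C \<le> Q n $ i"
      using z by (simp add: eq field_simps)
    moreover have "\<sigma> n $ i \<le> C"
      using C mw by (auto simp: is_max_weight_def)
    ultimately show "Y (Suc n) $ i = Y n $ i"
      using dY[of n i] by simp
  qed
  then show ?thesis by (simp add: eq interp_nth)
qed

text \<open>The schedule of a slot has maximal weight at \<open>Q n\<close>, so by scale invariance
  also at the scaled queue \<open>(1 / z) *\<^sub>R Q n\<close>; hence it cannot be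
  \<open>\<pi>\<close>.\<close>

lemma fluid_scaled_path_max_weight:
  assumes ut: "0 \<le> u" "u \<le> t"
    and nomax: "\<And>v. 0 \<le> v \<Longrightarrow> u - 1 / z < v \<Longrightarrow> v < t \<Longrightarrow> \<not> is_max_weight Sch R f (q v) \<pi>"
  shows "s \<pi> t = s \<pi> u"
proof -
  obtain Q A Y S where z: "1 \<le> z" and path: "mw_sample_path Sch R f Q A Y S" and
    eq: "\<And>t. q t = (1 / z) *\<^sub>R interp Q (z * t)" "\<And>\<pi> t. s \<pi> t = interp (S \<pi>) (z * t) / z"
    by (rule fluid_scaled_path_cases) (rule that; assumption)
  obtain \<sigma> where mw: "\<And>\<tau>. is_max_weight Sch R f (Q \<tau>) (\<sigma> \<tau>)" and Qpos: "\<And>\<tau>. nonneg_vec (Q \<tau>)"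
    and dS: "\<And>\<pi> \<tau>. S \<pi> (Suc \<tau>) - S \<pi> \<tau> = of_bool (\<sigma> \<tau> = \<pi>)"
    by (rule mw_sample_path_slots[OF net path]) (rule that; assumption)
  have scale_invariant: "is_max_weight Sch R f (\<kappa> *\<^sub>R p) \<rho>"
    if "nonneg_vec p" "is_max_weight Sch R f p \<rho>" "0 \<le> \<kappa>" for p \<rho> \<kappa>
    using net that unfolding network_data_def by blast
  have zut: "0 \<le> z * u" "z * u \<le> z * t"
    using z ut by (auto intro: mult_left_mono)
  have "interp (S \<pi>) (z * t) = interp (S \<pi>) (z * u)"
  proof (rule interp_eqI[OF zut])
    fix n assume "real n < z * t" "z * u < real n + 1"
    from nomax[OF slot_time[OF ut(1) this]] have "\<not> is_max_weight Sch R f ((1 / z) *\<^sub>R Q n) \<pi>"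
      using z by (simp add: eq)
    then have "\<sigma> n \<noteq> \<pi>"
      using scale_invariant[OF Qpos mw, of "1 / z"] z by auto
    then show "S \<pi> (Suc n) = S \<pi> n"
      using dS[of \<pi> n] by simp
  qed
  then show ?thesis by (simp add: eq)
qed

end

subsection \<open>Fluid limits\<close>

text \<open>Induction on the index set: each new index refines the subsequence found so far, and
  uniform limits survive the refinement. The uniform Lipschitz constant \<open>L\<close> supplies
  equicontinuity.\<close>

lemma Arzela_Ascoli_finite_family:
  fixes F :: "'i \<Rightarrow> nat \<Rightarrow> 'a::euclidean_space \<Rightarrow> 'b::{real_normed_vector,heine_borel}"
  assumes "finite I" and X: "compact X"
    and lip: "\<And>i k. i \<in> I \<Longrightarrow> L-lipschitz_on X (F i k)"
    and bound: "\<And>i k x. i \<in> I \<Longrightarrow> x \<in> X \<Longrightarrow> norm (F i k x) \<le> B"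
  shows "\<exists>r g. strict_mono (r :: nat \<Rightarrow> nat) \<and>
    (\<forall>i\<in>I. uniform_limit X (\<lambda>k. F i (r k)) (g i) sequentially)"
  using assms(1) lip bound
proof (induction I)
  case empty
  then show ?case using strict_mono_id by blast
next
  case (insert i I)
  then obtain r g where r: "strict_mono (r :: nat \<Rightarrow> nat)"
    and g: "\<And>j. j \<in> I \<Longrightarrow> uniform_limit X (\<lambda>k. F j (r k)) (g j) sequentially"
    by (metis insert_iff)
  have lip: "L-lipschitz_on X (F i (r k))" and bd: "x \<in> X \<Longrightarrow> norm (F i (r k) x) \<le> B" for k x
    using insert.prems by auto
  then have "0 \<le> L" using lipschitz_on_nonneg by blast
  have equi: "\<exists>d>0. \<forall>n y. y \<in> X \<and> norm (x - y) < d \<longrightarrow> norm (F i (r n) x - F i (r n) y) < e"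
    if "x \<in> X" "0 < e" for x e
  proof (intro exI[of _ "e / (L + 1)"] conjI allI impI)
    show "0 < e / (L + 1)" using \<open>0 \<le> L\<close> \<open>0 < e\<close> by simp
    fix n y assume y: "y \<in> X \<and> norm (x - y) < e / (L + 1)"
    have "norm (F i (r n) x - F i (r n) y) \<le> L * norm (x - y)"
      using lipschitz_on_normD[OF lip] y \<open>x \<in> X\<close> by blast
    also have "\<dots> \<le> L * (e / (L + 1))"
      using y \<open>0 \<le> L\<close> by (intro mult_left_mono) auto
    also have "\<dots> < e"
      using \<open>0 < e\<close> \<open>0 \<le> L\<close> by (simp add: field_simps)
    finally show "norm (F i (r n) x - F i (r n) y) < e" .
  qed
  obtain h r' where r': "strict_mono (r' :: nat \<Rightarrow> nat)"
    and h: "\<And>e. 0 < e \<Longrightarrow> \<exists>N. \<forall>n x. n \<ge> N \<and> x \<in> X \<longrightarrow> norm (F i (r (r' n)) x - h x) < e"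
    using Arzela_Ascoli[OF X, of "\<lambda>k. F i (r k)" B] bd equi by metis
  have h: "uniform_limit X (\<lambda>k. F i (r (r' k))) h sequentially"
    unfolding uniform_limit_sequentially_iff dist_norm using h by meson
  have "uniform_limit X (\<lambda>k. F j (r (r' k))) (g j) sequentially" if "j \<in> I" for j
    using filterlim_compose[OF g[OF that] filterlim_subseq[OF r']] .
  then have "\<forall>j\<in>insert i I. uniform_limit X (\<lambda>k. F j (r (r' k))) ((g(i := h)) j) sequentially"
    using h insert.hyps by auto
  moreover have "strict_mono (r \<circ> r')"
    using r r' by (rule strict_mono_o)
  ultimately show ?case
    by (intro exI[of _ "r \<circ> r'"] exI[of _ "g(i := h)"]) (auto simp: comp_def)
qed

text \<open>Stated with an existential constant: for absolute continuity of the limit any Lipschitz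
  constant serves, so none has to be computed.\<close>

lemma ex_lipschitz_on_sum:
  assumes "finite I" "\<And>i. i \<in> I \<Longrightarrow> \<exists>L. L-lipschitz_on X (g i)"
  shows "\<exists>L. L-lipschitz_on X (\<lambda>t. \<Sum>i\<in>I. g i t :: 'b::real_normed_vector)"
  using assms
proof (induction I)
  case (insert i I)
  then obtain L M where "L-lipschitz_on X (g i)" "M-lipschitz_on X (\<lambda>t. \<Sum>i\<in>I. g i t)"
    by blast
  then have "(L + M)-lipschitz_on X (\<lambda>t. g i t + (\<Sum>i\<in>I. g i t))"
    by (rule lipschitz_on_add)
  with insert.hyps show ?case by auto
qed (use lipschitz_on_constant in auto)

lemma ex_lipschitz_on_bounded_linear:
  assumes "bounded_linear h" "\<exists>L. L-lipschitz_on X g"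
  shows "\<exists>L. L-lipschitz_on X (\<lambda>t. h (g t))"
proof -
  obtain L where "L-lipschitz_on X g" using assms by blast
  moreover obtain B where "B-lipschitz_on (g ` X) h"
    using bounded_linear.lipschitz_boundE[OF assms(1)] by metis
  ultimately show ?thesis using lipschitz_on_compose2 by blast
qed

lemma lipschitz_on_componentwise:
  fixes g :: "'a::metric_space \<Rightarrow> real^'n::finite"
  assumes "\<And>i. L-lipschitz_on X (\<lambda>t. g t $ i)"
  shows "(real CARD('n) * L)-lipschitz_on X g"
proof (rule lipschitz_onI)
  show "0 \<le> real CARD('n) * L"
    using lipschitz_on_nonneg[OF assms] by simp
  fix t u assume "t \<in> X" "u \<in> X"
  then have "\<bar>(g t - g u) $ i\<bar> \<le> L * dist t u" for i
    using lipschitz_onD[OF assms, of t u i] by (simp add: dist_real_def)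
  from norm_le_if_components_le[of "g t - g u", OF this]
  show "dist (g t) (g u) \<le> real CARD('n) * L * dist t u"
    by (simp add: dist_norm mult.assoc)
qed

text \<open>The neighbourhood on which the approximants become constant is the same for all large
  \<open>k\<close>, so their pointwise limit is constant on it. Derivatives of the approximants
  never have to converge.\<close>

lemma DERIV_eq_0_if_limit_locally_constant:
  fixes g :: "nat \<Rightarrow> real \<Rightarrow> real"
  assumes "0 < d"
    and lim: "\<And>u. \<bar>t - u\<bar> < d \<Longrightarrow> (\<lambda>k. g k u) \<longlonglongrightarrow> h u"
    and const: "eventually (\<lambda>k. \<forall>u v. t - d < u \<and> u \<le> v \<and> v < t + d \<longrightarrow> g k v = g k u) sequentially"
    and "(h has_real_derivative D) (at t)"
  shows "D = 0"
proof (rule DERIV_local_const[OF assms(4) \<open>0 < d\<close>], intro allI impI)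
  fix u assume u: "\<bar>t - u\<bar> < d"
  have "eventually (\<lambda>k. g k u = g k t) sequentially"
    using const
  proof eventually_elim
    case (elim k)
    \<comment> \<open>Constancy is assumed for ordered pairs, so \<open>u\<close> left of
      \<open>t\<close> and \<open>u\<close> right of \<open>t\<close> use different
      instances.\<close>
    show ?case
      using elim[rule_format, of u t] elim[rule_format, of t u] u \<open>0 < d\<close> by (cases "u \<le> t") auto
  qed
  with lim[OF u] have "(\<lambda>k. g k t) \<longlonglongrightarrow> h u"
    by (rule Lim_transform_eventually)
  moreover have "(\<lambda>k. g k t) \<longlonglongrightarrow> h t"
    using lim \<open>0 < d\<close> by simp
  ultimately show "h t = h u"
    using LIMSEQ_unique by blast
qed

text \<open>Splits \<open>r\<close> in two halves: uniform convergence bounds the distance to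
  \<open>q'\<close>, continuity bounds the oscillation of \<open>q'\<close> around \<open>t\<close>.
  Shrinking \<open>d\<close> to the distance from the endpoints keeps the neighbourhood inside
  \<open>[0, T]\<close>.\<close>

lemma uniform_limit_eventually_near:
  fixes q :: "nat \<Rightarrow> real \<Rightarrow> 'a::metric_space"
  assumes lim: "uniform_limit {0..T} q q' sequentially" and cont: "continuous_on {0..T} q'"
    and t: "0 < t" "t < T" and r: "0 < r"
  obtains d where "0 < d" "d \<le> t" "t + d \<le> T"
    "eventually (\<lambda>k. \<forall>v. t - d < v \<and> v < t + d \<longrightarrow> dist (q k v) (q' t) < r) sequentially"
proof -
  have "\<exists>d>0. \<forall>v\<in>{0..T}. dist v t < d \<longrightarrow> dist (q' v) (q' t) < r / 2"
    using cont t r unfolding continuous_on_iff by (metis atLeastAtMost_iff half_gt_zero less_imp_le)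
  then obtain d where d: "0 < d" "\<And>v. v \<in> {0..T} \<Longrightarrow> dist v t < d \<Longrightarrow> dist (q' v) (q' t) < r / 2"
    by blast
  define d' where "d' = min d (min t (T - t))"
  have "eventually (\<lambda>k. \<forall>v\<in>{0..T}. dist (q k v) (q' v) < r / 2) sequentially"
    using uniform_limitD[OF lim, of "r / 2"] r by simp
  then have "eventually (\<lambda>k. \<forall>v. t - d' < v \<and> v < t + d' \<longrightarrow> dist (q k v) (q' t) < r) sequentially"
  proof eventually_elim
    case (elim k)
    show ?case
    proof (intro allI impI)
      fix v assume v: "t - d' < v \<and> v < t + d'"
      then have "v \<in> {0..T}" "dist v t < d"
        by (auto simp: d'_def dist_real_def)
      with elim d(2) have "dist (q k v) (q' v) < r / 2" "dist (q' v) (q' t) < r / 2"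
        by auto
      then show "dist (q k v) (q' t) < r"
        using dist_triangle[of "q k v" "q' t" "q' v"] by linarith
    qed
  qed
  moreover have "0 < d'" "d' \<le> t" "t + d' \<le> T"
    using d t by (auto simp: d'_def)
  ultimately show thesis using that by blast
qed

text \<open>Some \<open>\<rho>\<close> beats \<open>\<pi>\<close> strictly at \<open>p\<close>, and
  the weight gap is continuous in the queue vector. Continuity of \<open>f\<close> is available on
  the nonnegative half-line, hence the restriction to \<open>nonneg_vec v\<close>.\<close>

lemma not_max_weight_open:
  fixes Sch :: "(real^'n::finite) set"
  assumes net: "network_data Sch R f" and p: "nonneg_vec p" and \<pi>: "\<pi> \<in> Sch" "\<not> is_max_weight Sch R f p \<pi>"
  obtains r where "0 < r" "\<And>v. nonneg_vec v \<Longrightarrow> dist v p < r \<Longrightarrow> \<not> is_max_weight Sch R f v \<pi>"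
proof -
  obtain \<rho> where \<rho>: "\<rho> \<in> Sch" "mw_weight R f p \<pi> < mw_weight R f p \<rho>"
    using \<pi> by (auto simp: is_max_weight_def not_le)
  have "continuous_on {0..} f"
    using net unfolding network_data_def continuous_on_eq_continuous_within
    by (auto intro: differentiable_imp_continuous_within)
  then have *: "continuous_on {v. nonneg_vec v} (\<lambda>v :: real^'n. f (v $ i))" for i
    by (rule continuous_on_compose2) (auto intro!: continuous_intros simp: nonneg_vec_def)
  have "continuous_on {v. nonneg_vec v} (\<lambda>v :: real^'n. fvec f v)"
    unfolding fvec_def by (intro continuous_on_vec_lambda *)
  then have "continuous_on {v. nonneg_vec v} (\<lambda>v. mw_weight R f v \<rho> - mw_weight R f v \<pi>)"
    unfolding mw_weight_def
    by (intro continuous_intros bounded_linear.continuous_on[OF matrix_vector_mul_bounded_linear])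
  \<comment> \<open>The tolerance is the gap at \<open>p\<close> itself, so the gap at
    \<open>v\<close> stays positive.\<close>
  then obtain r where r: "0 < r" "\<And>v. nonneg_vec v \<Longrightarrow> dist v p < r \<Longrightarrow>
      dist (mw_weight R f v \<rho> - mw_weight R f v \<pi>) (mw_weight R f p \<rho> - mw_weight R f p \<pi>)
        < mw_weight R f p \<rho> - mw_weight R f p \<pi>"
    using p \<rho>(2) unfolding continuous_on_iff by (metis diff_gt_0_iff_gt mem_Collect_eq)
  show thesis
  proof (rule that[OF r(1)])
    fix v assume "nonneg_vec v" "dist v p < r"
    from r(2)[OF this] have "mw_weight R f v \<pi> < mw_weight R f v \<rho>"
      by (simp add: dist_real_def)
    with \<rho>(1) show "\<not> is_max_weight Sch R f v \<pi>"
      by (auto simp: is_max_weight_def not_le)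
  qed
qed

text \<open>The norms match what is at hand later: uniform limits bound the Euclidean norm, which
  dominates \<open>maxnorm\<close>, while the arrivals are controlled in \<open>maxnorm\<close>
  directly.\<close>

lemma pdist_le:
  assumes "finite Sch" "0 \<le> T" "0 \<le> e"
    and "\<And>t. t \<in> {0..T} \<Longrightarrow> norm (q t - q' t) \<le> e" "\<And>t. t \<in> {0..T} \<Longrightarrow> maxnorm (a t - a' t) \<le> e"
    "\<And>t. t \<in> {0..T} \<Longrightarrow> norm (y t - y' t) \<le> e"
    "\<And>t \<pi>. t \<in> {0..T} \<Longrightarrow> \<pi> \<in> Sch \<Longrightarrow> \<bar>s \<pi> t - s' \<pi> t\<bar> \<le> e"
  shows "pdist Sch T (q, a, y, s) (q', a', y', s') \<le> e"
  unfolding pdist_def prod.case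
proof (rule cSUP_least)
  fix t assume t: "t \<in> {0..T}"
  have "Max (insert 0 ((\<lambda>\<pi>. \<bar>s \<pi> t - s' \<pi> t\<bar>) ` Sch)) \<le> e"
    using assms t by (subst Max_le_iff) auto
  then show "max (maxnorm (q t - q' t)) (max (maxnorm (a t - a' t))
        (max (maxnorm (y t - y' t)) (Max (insert 0 ((\<lambda>\<pi>. \<bar>s \<pi> t - s' \<pi> t\<bar>) ` Sch))))) \<le> e"
    using assms(4-6)[OF t] maxnorm_le_norm[of "q t - q' t"] maxnorm_le_norm[of "y t - y' t"] by simp
qed (use assms in auto)

text \<open>Equations, bounds and monotonicity pass to pointwise limits, and Lipschitz bounds give
  absolute continuity. Uniform convergence is assumed for \<open>q\<close>, because the two
  derivative conditions need the prelimit queues controlled on a whole neighbourhood of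
  \<open>t\<close>.\<close>

lemma fluid_limit_in_FMS:
  fixes Sch :: "(real^'n::finite) set" and s :: "nat \<Rightarrow> real^'n \<Rightarrow> real \<Rightarrow> real"
  assumes net: "network_data Sch R f" and T: "0 < T" and lam: "nonneg_vec lam"
    and paths: "\<And>k. ((q k, a k, y k, s k), z k) \<in> fluid_scaled_paths Sch R f"
    and z: "filterlim z at_top sequentially"
    and q: "uniform_limit {0..T} q q' sequentially"
    and a: "\<And>t. t \<in> {0..T} \<Longrightarrow> (\<lambda>k. a k t) \<longlonglongrightarrow> t *\<^sub>R lam"
    and y: "\<And>t. t \<in> {0..T} \<Longrightarrow> (\<lambda>k. y k t) \<longlonglongrightarrow> y' t"
    and s: "\<And>\<pi> t. \<pi> \<in> Sch \<Longrightarrow> t \<in> {0..T} \<Longrightarrow> (\<lambda>k. s k \<pi> t) \<longlonglongrightarrow> s' \<pi> t"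
  shows "(q', \<lambda>t. t *\<^sub>R lam, y', s') \<in> FMS Sch R f T lam"
proof -
  have fin: "finite Sch" using net by (simp add: network_data_def)
  obtain C where C: "0 \<le> C" "\<And>\<pi> i. \<pi> \<in> Sch \<Longrightarrow> \<pi> $ i \<le> C"
    using schedules_bounded[OF net] by metis
  note initial = fluid_scaled_path_initial[OF net paths]
  note static = fluid_scaled_path_static[OF net paths]
  note increments = fluid_scaled_path_increments[OF net paths C(2)]
  have z1: "1 \<le> z k" for k by (rule fluid_scaled_path_z[OF net paths])
  have q_lim: "(\<lambda>k. q k t) \<longlonglongrightarrow> q' t" if "t \<in> {0..T}" for t
    using tendsto_uniform_limitI[OF q that] .
  have y_lim: "(\<lambda>k. y k t $ i) \<longlonglongrightarrow> y' t $ i" if "t \<in> {0..T}" for t i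
    using tendsto_vec_nth[OF y[OF that]] .
  have B_lim: "(\<lambda>k. \<Sum>\<pi>\<in>Sch. s k \<pi> t *\<^sub>R \<pi>) \<longlonglongrightarrow> (\<Sum>\<pi>\<in>Sch. s' \<pi> t *\<^sub>R \<pi>)" if "t \<in> {0..T}" for t
    using s that by (intro tendsto_intros)

  have y_incr: "y k u $ i \<le> y k t $ i \<and> y k t $ i - y k u $ i \<le> C * (t - u)"
    if "u \<in> {0..T}" "u \<le> t" for k u t i
    using increments(1,2)[of u t k i] that C(1) by (simp add: max_absorb2)
  have y_lip: "mono_on {0..T} (\<lambda>t. y' t $ i)" "C-lipschitz_on {0..T} (\<lambda>t. y' t $ i)" for i
    by (rule Lipschitz_limit[where g = "\<lambda>k t. y k t $ i", OF y_lim C(1) y_incr]; assumption)+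
  have s_incr: "s k \<pi> u \<le> s k \<pi> t \<and> s k \<pi> t - s k \<pi> u \<le> 1 * (t - u)"
    if "u \<in> {0..T}" "u \<le> t" for k u t \<pi>
    using increments(3,4)[of u t k \<pi>] that by simp
  have s_lip: "mono_on {0..T} (s' \<pi>)" "1-lipschitz_on {0..T} (s' \<pi>)" if "\<pi> \<in> Sch" for \<pi>
    by (rule Lipschitz_limit[where g = "\<lambda>k. s k \<pi>", OF s[OF that] zero_le_one s_incr]; assumption)+
  have y0: "y' 0 = 0"
    using LIMSEQ_unique[OF y[of 0]] T by (simp add: initial)
  have s0: "s' \<pi> 0 = 0" if "\<pi> \<in> Sch" for \<pi>
    using LIMSEQ_unique[OF s[OF that, of 0]] T by (simp add: initial)

  have q_nonneg: "nonneg_vec (q' t)" if "t \<in> {0..T}" for t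
    unfolding nonneg_vec_def
  proof
    fix i
    have "0 \<le> q k t $ i" for k
      using static(1)[of t] that by (simp add: nonneg_vec_def)
    then show "0 \<le> q' t $ i"
      using LIMSEQ_le_const[OF tendsto_vec_nth[OF q_lim[OF that]]] by blast
  qed
  have q_eq: "q' t = q' 0 + t *\<^sub>R lam - (ident - transpose R) *v ((\<Sum>\<pi>\<in>Sch. s' \<pi> t *\<^sub>R \<pi>) - y' t)"
    if t: "t \<in> {0..T}" for t
  proof (rule LIMSEQ_unique[OF q_lim[OF t]])
    have "(\<lambda>k. q k 0 + a k t - (ident - transpose R) *v ((\<Sum>\<pi>\<in>Sch. s k \<pi> t *\<^sub>R \<pi>) - y k t)) \<longlonglongrightarrow>
        q' 0 + t *\<^sub>R lam - (ident - transpose R) *v ((\<Sum>\<pi>\<in>Sch. s' \<pi> t *\<^sub>R \<pi>) - y' t)"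
      using T t by (intro tendsto_intros q_lim a B_lim y
          bounded_linear.tendsto[OF matrix_vector_mul_bounded_linear]) auto
    then show "(\<lambda>k. q k t) \<longlonglongrightarrow>
        q' 0 + t *\<^sub>R lam - (ident - transpose R) *v ((\<Sum>\<pi>\<in>Sch. s' \<pi> t *\<^sub>R \<pi>) - y' t)"
      using t by (subst static(2)) auto
  qed
  \<comment> \<open>The limit queue inherits its regularity from the other components through
    \<open>q_eq\<close>.\<close>
  obtain L where q_lip: "L-lipschitz_on {0..T} q'"
  proof -
    let ?B = "\<lambda>t. \<Sum>\<pi>\<in>Sch. s' \<pi> t *\<^sub>R \<pi>"
    have "\<exists>L. L-lipschitz_on {0..T} ?B"
      using s_lip by (intro ex_lipschitz_on_sum ex_lipschitz_on_bounded_linear[OF bounded_linear_scaleR_left]) (auto simp: fin)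
    then have "\<exists>L. L-lipschitz_on {0..T} (\<lambda>t. ?B t - y' t)"
      using lipschitz_on_diff lipschitz_on_componentwise[of C "{0..T}" y', OF y_lip(2)] by blast
    then have "\<exists>L. L-lipschitz_on {0..T} (\<lambda>t. (ident - transpose R) *v (?B t - y' t))"
      by (rule ex_lipschitz_on_bounded_linear[OF matrix_vector_mul_bounded_linear])
    then obtain L where L: "L-lipschitz_on {0..T} (\<lambda>t. (ident - transpose R) *v (?B t - y' t))"
      by blast
    have "\<exists>L. L-lipschitz_on {0..T} (\<lambda>t. t *\<^sub>R lam)"
      by (intro ex_lipschitz_on_bounded_linear[OF bounded_linear_scaleR_left]) (blast intro: lipschitz_on_id)
    then obtain M where M: "M-lipschitz_on {0..T} (\<lambda>t. t *\<^sub>R lam)" by blast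
    have "(0 + M + L)-lipschitz_on {0..T} (\<lambda>t. q' 0 + t *\<^sub>R lam - (ident - transpose R) *v (?B t - y' t))"
      by (intro lipschitz_on_diff lipschitz_on_add lipschitz_on_constant L M)
    then have "(0 + M + L)-lipschitz_on {0..T} q'"
      by (rule lipschitz_on_transform) (rule q_eq)
    then show thesis by (rule that)
  qed
  have q_cont: "continuous_on {0..T} q'" using q_lip by (rule lipschitz_on_continuous_on)
  have ac_nth: "abs_continuous_on 0 T (\<lambda>t. h t $ i)"
    if "\<exists>L. L-lipschitz_on {0..T} h" for h :: "real \<Rightarrow> real^'n" and i
    using ex_lipschitz_on_bounded_linear[OF bounded_linear_vec_nth[of i] that]
    by (elim exE) (rule lipschitz_on_imp_abs_continuous_on)
  have q_ac: "abs_continuous_on 0 T (\<lambda>t. q' t $ i)" for i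
    using q_lip by (intro ac_nth) blast
  have a_ac: "abs_continuous_on 0 T (\<lambda>t. (t *\<^sub>R lam) $ i)" for i
    by (intro ac_nth ex_lipschitz_on_bounded_linear[OF bounded_linear_scaleR_left]) (blast intro: lipschitz_on_id)

  have z_large: "eventually (\<lambda>k. 1 / z k < d) sequentially" if "0 < d" for d
    using filterlim_at_top_dense[THEN iffD1, OF z, rule_format, of "1 / d"]
  proof eventually_elim
    case (elim k)
    then show ?case using that z1[of k] by (simp add: field_simps)
  qed
  have y_deriv: "D = 0"
    if t: "t \<in> {0<..<T}" and D: "((\<lambda>u. y' u $ i) has_real_derivative D) (at t)" and pos: "0 < q' t $ i" for t i D
  proof -
    \<comment> \<open>Within distance \<open>r\<close> of \<open>q' t\<close> the
      \<open>i\<close>-th queue is still at least \<open>r\<close>, and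
      \<open>1 / z k < r / (C + 1)\<close> yields the required level
      \<open>C / z k \<le> r\<close>.\<close>
    define r where "r = q' t $ i / 2"
    have r: "0 < r" using pos by (simp add: r_def)
    with C(1) have "0 < r / (C + 1)" by simp
    note z_large_C = z_large[OF this]
    obtain d where d: "0 < d" "d \<le> t" "t + d \<le> T" and near:
      "eventually (\<lambda>k. \<forall>v. t - d < v \<and> v < t + d \<longrightarrow> dist (q k v) (q' t) < r) sequentially"
      using uniform_limit_eventually_near[OF q q_cont _ _ r, of t] t by auto
    \<comment> \<open>Constancy is claimed on radius \<open>d / 2\<close>: the busy condition
      reaches back by a further \<open>1 / z k\<close>, which is below \<open>d / 2\<close> for
      large \<open>k\<close> and so stays within radius \<open>d\<close>.\<close>
    have "0 < d / 2" using d by simp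
    note z_large_d = z_large[OF this]
    have "eventually (\<lambda>k. \<forall>u v. t - d / 2 < u \<and> u \<le> v \<and> v < t + d / 2 \<longrightarrow> y k v $ i = y k u $ i) sequentially"
      using near z_large_d z_large_C
    proof (eventually_elim, goal_cases)
      case (1 k)
      then have small: "1 / z k < d / 2" "1 / z k < r / (C + 1)"
        using r C(1) by auto
      have "C / z k \<le> (C + 1) * (1 / z k)"
        using z1[of k] by (simp add: divide_right_mono)
      also have "\<dots> \<le> r"
        using small(2) C(1) by (simp add: field_simps)
      finally have "C / z k \<le> r" .
      moreover have "r \<le> q k v $ i" if "t - d < v" "v < t + d" for v
        using 1(1)[rule_format, of v] that component_le_norm_cart[of "q k v - q' t" i]
        by (auto simp: dist_norm r_def)
      ultimately have busy: "C / z k \<le> q k v $ i" if "t - d < v" "v < t + d" for v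
        using that by force
      show ?case
        using small d by (intro allI impI fluid_scaled_path_no_idling[OF net paths C(2)] busy) auto
    qed
    moreover have "u \<in> {0..T}" if "\<bar>t - u\<bar> < d / 2" for u
      using that d unfolding atLeastAtMost_iff by linarith
    ultimately show ?thesis
      using DERIV_eq_0_if_limit_locally_constant[OF \<open>0 < d / 2\<close> y_lim _ D] by blast
  qed
  have s_deriv: "D = 0"
    if t: "t \<in> {0<..<T}" and \<pi>: "\<pi> \<in> Sch" and D: "(s' \<pi> has_real_derivative D) (at t)"
      and nomax: "\<not> is_max_weight Sch R f (q' t) \<pi>" for t \<pi> D
  proof -
    have "nonneg_vec (q' t)" using q_nonneg t by simp
    then obtain r where r: "0 < r"
      "\<And>v. nonneg_vec v \<Longrightarrow> dist v (q' t) < r \<Longrightarrow> \<not> is_max_weight Sch R f v \<pi>"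
      using not_max_weight_open[OF net _ \<pi> nomax] by blast
    obtain d where d: "0 < d" "d \<le> t" "t + d \<le> T" and near:
      "eventually (\<lambda>k. \<forall>v. t - d < v \<and> v < t + d \<longrightarrow> dist (q k v) (q' t) < r) sequentially"
      using uniform_limit_eventually_near[OF q q_cont _ _ r(1), of t] t by auto
    \<comment> \<open>Again half the radius is reserved for the slot that straddles the left
      end.\<close>
    have "0 < d / 2" using d by simp
    note z_large_d = z_large[OF this]
    have "eventually (\<lambda>k. \<forall>u v. t - d / 2 < u \<and> u \<le> v \<and> v < t + d / 2 \<longrightarrow> s k \<pi> v = s k \<pi> u) sequentially"
      using near z_large_d
    proof (eventually_elim, goal_cases)
      case (1 k)
      then have small: "1 / z k < d / 2" by auto
      have "\<not> is_max_weight Sch R f (q k v) \<pi>" if "t - d < v" "v < t + d" for v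
        using 1(1) that d by (intro r(2) static(1)) auto
      then show ?case
        using small d by (intro allI impI fluid_scaled_path_max_weight[OF net paths]) auto
    qed
    moreover have "u \<in> {0..T}" if "\<bar>t - u\<bar> < d / 2" for u
      using that d unfolding atLeastAtMost_iff by linarith
    ultimately show ?thesis
      using DERIV_eq_0_if_limit_locally_constant[OF \<open>0 < d / 2\<close> s[OF \<pi>] _ D] by blast
  qed

  have y_nonneg: "nonneg_vec (y' t)" if "t \<in> {0..T}" for t
    using mono_onD[OF y_lip(1), of 0 t] that T y0 by (auto simp: nonneg_vec_def)
  have s_nonneg: "0 \<le> s' \<pi> t" if "\<pi> \<in> Sch" "t \<in> {0..T}" for \<pi> t
    using mono_onD[OF s_lip(1)[OF that(1)], of 0 t] that T s0 by auto
  have sum_s: "(\<Sum>\<pi>\<in>Sch. s' \<pi> t) = t" if t: "t \<in> {0..T}" for t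
  proof (rule LIMSEQ_unique)
    show "(\<lambda>k. \<Sum>\<pi>\<in>Sch. s k \<pi> t) \<longlonglongrightarrow> (\<Sum>\<pi>\<in>Sch. s' \<pi> t)"
      using s t by (intro tendsto_intros)
    show "(\<lambda>k. \<Sum>\<pi>\<in>Sch. s k \<pi> t) \<longlonglongrightarrow> t"
      using t by (simp add: static(3))
  qed
  have y_le: "y' t $ i \<le> (\<Sum>\<pi>\<in>Sch. s' \<pi> t *\<^sub>R \<pi>) $ i" if t: "t \<in> {0..T}" for t i
  proof (rule LIMSEQ_le[OF y_lim[OF t] tendsto_vec_nth[OF B_lim[OF t]]])
    show "\<exists>N. \<forall>k\<ge>N. y k t $ i \<le> (\<Sum>\<pi>\<in>Sch. s k \<pi> t *\<^sub>R \<pi>) $ i"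
      using static(4) t by auto
  qed
  have a_nonneg: "nonneg_vec (t *\<^sub>R lam)" if "t \<in> {0..T}" for t
    using lam that by (simp add: nonneg_vec_def)
  have y_ac: "abs_continuous_on 0 T (\<lambda>t. y' t $ i)" for i
    using lipschitz_on_imp_abs_continuous_on[OF y_lip(2)] .
  have s_ac: "abs_continuous_on 0 T (s' \<pi>)" if "\<pi> \<in> Sch" for \<pi>
    using lipschitz_on_imp_abs_continuous_on[OF s_lip(2)[OF that]] .
  show ?thesis
    unfolding FMS_def mem_Collect_eq prod.case
    by (intro conjI ballI allI impI; (elim conjE)?)
      (rule q_nonneg a_nonneg y_nonneg s_nonneg q_ac a_ac y_ac s_ac q_eq refl sum_s y_le
        y_lip(1) s_lip(1) y_deriv s_deriv; assumption)+
qed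

section \<open>Compactness and existence of fluid limits\<close>

lemma uniform_limit_sum:
  fixes g :: "'i \<Rightarrow> 'k \<Rightarrow> 'a \<Rightarrow> 'b::real_normed_vector"
  assumes "finite I" "\<And>i. i \<in> I \<Longrightarrow> uniform_limit X (g i) (h i) F"
  shows "uniform_limit X (\<lambda>k x. \<Sum>i\<in>I. g i k x) (\<lambda>x. \<Sum>i\<in>I. h i x) F"
  using assms by (induction I) (auto intro: uniform_limit_const uniform_limit_add)

text \<open>The constant is obtained before the path and \<open>z\<close> are fixed, so it serves a
  whole sequence of paths. Passing from components to the Euclidean norm costs the factor
  \<open>CARD('n)\<close>.\<close>

lemma fluid_scaled_path_equi_lipschitz:
  fixes Sch :: "(real^'n::finite) set"
  assumes net: "network_data Sch R f"
  obtains C where "0 \<le> C" "\<And>q a y s z T. ((q, a, y, s), z) \<in> fluid_scaled_paths Sch R f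
    \<Longrightarrow> C-lipschitz_on {0..T} y \<and> (\<forall>\<pi>. 1-lipschitz_on {0..T} (s \<pi>))"
proof -
  obtain C where C: "0 \<le> C" "\<And>\<pi> i. \<pi> \<in> Sch \<Longrightarrow> \<pi> $ i \<le> C"
    using schedules_bounded[OF net] by metis
  show thesis
  proof (rule that[of "real CARD('n) * C"], goal_cases)
    case (2 q a y s z T)
    note increments = fluid_scaled_path_increments[OF net 2 C(2)]
    have "C-lipschitz_on {0..T} (\<lambda>t. y t $ i)" for i
    proof (rule lipschitz_on_leI[OF _ C(1)])
      fix u t :: real assume "u \<in> {0..T}" "t \<in> {0..T}" "u \<le> t"
      then show "dist (y u $ i) (y t $ i) \<le> C * dist u t"
        using increments(1,2)[of u t i] C(1) by (simp add: dist_real_def max_absorb2)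
    qed
    then have "(real CARD('n) * C)-lipschitz_on {0..T} y"
      by (rule lipschitz_on_componentwise)
    moreover have "1-lipschitz_on {0..T} (s \<pi>)" for \<pi>
    proof (rule lipschitz_on_leI)
      fix u t :: real assume "u \<in> {0..T}" "t \<in> {0..T}" "u \<le> t"
      then show "dist (s \<pi> u) (s \<pi> t) \<le> 1 * dist u t"
        using increments(3,4)[of u t \<pi>] by (simp add: dist_real_def)
    qed simp
    ultimately show ?case by blast
  qed (use C in simp)
qed

lemma norm_le_if_lipschitz_from_0:
  assumes "C-lipschitz_on {0..T} g" "g 0 = 0" "t \<in> {0..T}"
  shows "norm (g t) \<le> C * T"
proof -
  have "norm (g t - g 0) \<le> C * norm (t - 0)"
    using assms by (intro lipschitz_on_normD[OF assms(1)]) auto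
  also have "\<dots> \<le> C * T"
    using assms lipschitz_on_nonneg[OF assms(1)] by (intro mult_left_mono) auto
  finally show ?thesis using assms by simp
qed

text \<open>Compactness is applied to \<open>y\<close>, \<open>s\<close> and the initial queue. The
  arrivals converge by hypothesis, and the queue then converges because it is an affine image of
  these data.\<close>

lemma fluid_limit_exists:
  fixes Sch :: "(real^'n::finite) set" and q a y :: "nat \<Rightarrow> real \<Rightarrow> real^'n"
  assumes net: "network_data Sch R f" and T: "0 < T" and lam: "nonneg_vec lam"
    and paths: "\<And>k. ((q k, a k, y k, s k), z k) \<in> fluid_scaled_paths Sch R f"
    and z: "filterlim z at_top sequentially"
    and a: "\<And>k t. t \<in> {0..T} \<Longrightarrow> maxnorm (a k t - t *\<^sub>R lam) \<le> \<delta> k" and \<delta>: "\<delta> \<longlonglongrightarrow> 0"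
    and init: "\<And>k. maxnorm (q k 0) \<le> K"
  obtains r x where "strict_mono (r :: nat \<Rightarrow> nat)" "x \<in> FMS Sch R f T lam" "(\<lambda>k. q (r k) 0) \<longlonglongrightarrow> fst x 0"
    "\<forall>e>0. eventually (\<lambda>k. pdist Sch T (q (r k), a (r k), y (r k), s (r k)) x \<le> e) sequentially"
proof -
  let ?M = "ident - transpose R"
  have fin: "finite Sch" using net by (simp add: network_data_def)
  obtain \<pi>0 where \<pi>0: "\<pi>0 \<in> Sch" using net by (auto simp: network_data_def)
  note initial = fluid_scaled_path_initial[OF net paths]
  obtain C where C: "\<And>k. C-lipschitz_on {0..T} (y k)" "\<And>k \<pi>. 1-lipschitz_on {0..T} (s k \<pi>)"
    using fluid_scaled_path_equi_lipschitz[OF net] paths by metis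
  \<comment> \<open>Bundling the three bounded families gives a common subsequence from one application of Arzela-Ascoli.\<close>
  define F where "F \<pi> k t = (y k t, q k 0, s k \<pi> t)" for \<pi> k t
  \<comment> \<open>The constant produced by two uses of \<open>lipschitz_on_Pair\<close>:
    \<open>C\<close> for \<open>y\<close>, 0 for the constant \<open>q k 0\<close>, 1 for
    \<open>s\<close>.\<close>
  define L where "L = sqrt (C\<^sup>2 + (sqrt (0\<^sup>2 + 1\<^sup>2))\<^sup>2)"
  have F_lip: "L-lipschitz_on {0..T} (F \<pi> k)" for \<pi> k
    unfolding L_def F_def by (intro lipschitz_on_Pair lipschitz_on_constant C)
  have F_bound: "norm (F \<pi> k t) \<le> C * T + (real CARD('n) * K + 1 * T)" if "t \<in> {0..T}" for \<pi> k t
  proof -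
    have "norm (q k 0) \<le> real CARD('n) * K"
      using norm_le_maxnorm[of "q k 0"] init[of k] by (meson mult_left_mono of_nat_0_le_iff order_trans)
    then show ?thesis
      unfolding F_def using that
      by (intro order_trans[OF norm_Pair_le] add_mono norm_le_if_lipschitz_from_0[where g = "y k"]
          norm_le_if_lipschitz_from_0[where g = "s k \<pi>"] C) (auto simp: initial)
  qed
  have "\<exists>r g. strict_mono (r :: nat \<Rightarrow> nat) \<and>
      (\<forall>\<pi>\<in>Sch. uniform_limit {0..T} (\<lambda>k. F \<pi> (r k)) (g \<pi>) sequentially)"
    by (rule Arzela_Ascoli_finite_family[OF fin compact_Icc F_lip F_bound])
  then obtain r g where r: "strict_mono (r :: nat \<Rightarrow> nat)"
    and g: "\<And>\<pi>. \<pi> \<in> Sch \<Longrightarrow> uniform_limit {0..T} (\<lambda>k. F \<pi> (r k)) (g \<pi>) sequentially"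
    by blast
  \<comment> \<open>The first two entries of \<open>F \<pi>\<close> do not depend on
    \<open>\<pi>\<close>, so their limits can be read off at any schedule, here
    \<open>\<pi>0\<close>.\<close>
  define y' where "y' t = fst (g \<pi>0 t)" for t
  define q0 where "q0 t = fst (snd (g \<pi>0 t))" for t
  define s' where "s' \<pi> t = snd (snd (g \<pi> t))" for \<pi> t
  define q' where "q' t = q0 t + t *\<^sub>R lam - ?M *v ((\<Sum>\<pi>\<in>Sch. s' \<pi> t *\<^sub>R \<pi>) - y' t)" for t
  have y_lim: "uniform_limit {0..T} (\<lambda>k. y (r k)) y' sequentially"
    using bounded_linear.uniform_limit[OF bounded_linear_fst g[OF \<pi>0]] by (simp add: F_def y'_def[abs_def])
  have q0_lim: "uniform_limit {0..T} (\<lambda>k t. q (r k) 0) q0 sequentially"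
    using bounded_linear.uniform_limit[OF bounded_linear_fst
        bounded_linear.uniform_limit[OF bounded_linear_snd g[OF \<pi>0]]] by (simp add: F_def q0_def[abs_def])
  have s_lim: "uniform_limit {0..T} (\<lambda>k. s (r k) \<pi>) (s' \<pi>) sequentially" if "\<pi> \<in> Sch" for \<pi>
    using bounded_linear.uniform_limit[OF bounded_linear_snd
        bounded_linear.uniform_limit[OF bounded_linear_snd g[OF that]]] by (simp add: F_def s'_def[abs_def])
  have \<delta>_r: "(\<lambda>k. \<delta> (r k)) \<longlonglongrightarrow> 0"
    using filterlim_compose[OF \<delta> filterlim_subseq[OF r]] .
  have a_lim: "uniform_limit {0..T} (\<lambda>k. a (r k)) (\<lambda>t. t *\<^sub>R lam) sequentially"
  proof (rule uniform_limitI)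
    fix e :: real assume "0 < e"
    then have "eventually (\<lambda>k. \<delta> (r k) < e / real CARD('n)) sequentially"
      using order_tendstoD(2)[OF \<delta>_r] by simp
    then show "eventually (\<lambda>k. \<forall>t\<in>{0..T}. dist (a (r k) t) (t *\<^sub>R lam) < e) sequentially"
    proof eventually_elim
      case (elim k)
      show ?case
      proof
        fix t assume t: "t \<in> {0..T}"
        have "dist (a (r k) t) (t *\<^sub>R lam) \<le> real CARD('n) * maxnorm (a (r k) t - t *\<^sub>R lam)"
          unfolding dist_norm by (rule norm_le_maxnorm)
        also have "\<dots> \<le> real CARD('n) * \<delta> (r k)"
          using a[OF t] by (intro mult_left_mono) auto
        also have "\<dots> < e"
          using elim by (simp add: field_simps)
        finally show "dist (a (r k) t) (t *\<^sub>R lam) < e" .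
      qed
    qed
  qed
  have q_lim: "uniform_limit {0..T} (\<lambda>k. q (r k)) q' sequentially"
  proof -
    have "uniform_limit {0..T} (\<lambda>k t. \<Sum>\<pi>\<in>Sch. s (r k) \<pi> t *\<^sub>R \<pi>)
        (\<lambda>t. \<Sum>\<pi>\<in>Sch. s' \<pi> t *\<^sub>R \<pi>) sequentially"
      by (rule uniform_limit_sum[OF fin bounded_linear.uniform_limit[OF bounded_linear_scaleR_left s_lim]])
    from bounded_linear.uniform_limit[OF matrix_vector_mul_bounded_linear uniform_limit_minus[OF this y_lim], of ?M]
    have lim: "uniform_limit {0..T} (\<lambda>k t. q (r k) 0 + a (r k) t
        - ?M *v ((\<Sum>\<pi>\<in>Sch. s (r k) \<pi> t *\<^sub>R \<pi>) - y (r k) t)) q' sequentially"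
      unfolding q'_def[abs_def] by (rule uniform_limit_minus[OF uniform_limit_add[OF q0_lim a_lim]])
    have "q (r k) t = q (r k) 0 + a (r k) t
        - ?M *v ((\<Sum>\<pi>\<in>Sch. s (r k) \<pi> t *\<^sub>R \<pi>) - y (r k) t)" if "t \<in> {0..T}" for k t
      using that by (intro fluid_scaled_path_static(2)[OF net paths]) simp
    then show ?thesis
      by (rule uniform_limit_cong'[THEN iffD2, OF _ refl lim])
  qed
  have FMS: "(q', \<lambda>t. t *\<^sub>R lam, y', s') \<in> FMS Sch R f T lam"
    by (rule fluid_limit_in_FMS[OF net T lam paths filterlim_compose[OF z filterlim_subseq[OF r]] q_lim
          tendsto_uniform_limitI[OF a_lim] tendsto_uniform_limitI[OF y_lim] tendsto_uniform_limitI[OF s_lim]])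
  show thesis
  proof (rule that[OF r FMS]; (intro allI impI)?)
    show "(\<lambda>k. q (r k) 0) \<longlonglongrightarrow> fst (q', \<lambda>t. t *\<^sub>R lam, y', s') 0"
      using tendsto_uniform_limitI[OF q_lim, of 0] T by simp
    fix e :: real assume e: "0 < e"
    have "eventually (\<lambda>k. \<forall>\<pi>\<in>Sch. \<forall>t\<in>{0..T}. dist (s (r k) \<pi> t) (s' \<pi> t) < e) sequentially"
      using uniform_limitD[OF s_lim e] fin by (simp add: eventually_ball_finite_distrib)
    with uniform_limitD[OF q_lim e] uniform_limitD[OF y_lim e] order_tendstoD(2)[OF \<delta>_r e]
    show "eventually (\<lambda>k. pdist Sch T (q (r k), a (r k), y (r k), s (r k))
        (q', \<lambda>t. t *\<^sub>R lam, y', s') \<le> e) sequentially"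
    proof eventually_elim
      case (elim k)
      show ?case
      proof (rule pdist_le)
        show "maxnorm (a (r k) t - t *\<^sub>R lam) \<le> e" if "t \<in> {0..T}" for t
          using a[OF that, of "r k"] elim by linarith
      qed (use elim e T fin in \<open>auto simp: dist_norm less_imp_le\<close>)
    qed
  qed
qed

section \<open>Uniform convergence to the fluid model solutions\<close>

theorem theorem4p3:
  fixes Sch :: "(real^'n::finite) set" and R :: "real^'n^'n" and f :: "real \<Rightarrow> real"
    and T K :: real and lam :: "real^'n"
    and eps :: "'j::{linorder,countable} \<Rightarrow> real" and lamj :: "'j \<Rightarrow> real^'n"
    and G :: "'j \<Rightarrow> ('n cpath \<times> real) set"
  assumes net: "network_data Sch R f"
    and T_pos: "0 < T" and K_pos: "0 < K" and lam_nonneg: "nonneg_vec lam"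
    and eps_nonneg: "\<forall>j. 0 \<le> eps j" and lamj_nonneg: "\<forall>j. nonneg_vec (lamj j)"
    and eps_lim: "(eps \<longlongrightarrow> 0) at_top"
    and lamj_lim: "(lamj \<longlongrightarrow> lam) at_top"
    and G_sub: "\<forall>j. G j \<subseteq> fluid_scaled_paths Sch R f"
    and z_inf: "\<forall>M. eventually (\<lambda>j. \<forall>(x, z) \<in> G j. M \<le> z) at_top"
    and arr: "\<forall>j. \<forall>(x, z) \<in> G j. \<forall>t\<in>{0..T}.
                 maxnorm (fst (snd x) t - t *\<^sub>R lamj j) \<le> eps j"
    and init: "\<forall>j. \<forall>(x, z) \<in> G j. maxnorm (fst x 0) \<le> K"
  shows "(\<forall>e>0. eventually (\<lambda>j. \<forall>(x, z) \<in> G j.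
                 pdist_set Sch T x (FMS_K Sch R f T lam K) < ereal e) at_top)
       \<and> (\<forall>(q0 :: real^'n) (eps' :: 'j \<Rightarrow> real).
            nonneg_vec q0 \<and> (eps' \<longlongrightarrow> 0) at_top \<and>
            (\<forall>j. \<forall>(x, z) \<in> G j. maxnorm (fst x 0 - q0) \<le> eps' j) \<longrightarrow>
            (\<forall>e>0. eventually (\<lambda>j. \<forall>(x, z) \<in> G j.
                 pdist_set Sch T x (FMS_q0 Sch R f T lam q0) < ereal e) at_top))"
proof -
  \<comment> \<open>\<open>E\<close> stands for either of the two target sets; \<open>\<eta>\<close> is an extra null sequence that controls the
    initial states in the second case.\<close>
  have main: "eventually (\<lambda>j. \<forall>(x, z) \<in> G j. pdist_set Sch T x E < ereal e) at_top"
    if e: "0 < e" and \<eta>: "(\<eta> \<longlongrightarrow> (0::real)) at_top"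
      and E: "\<And>x z j x'. (\<And>k. (x k, z k) \<in> G (j k)) \<Longrightarrow> (\<lambda>k. \<eta> (j k)) \<longlonglongrightarrow> 0 \<Longrightarrow>
        (\<lambda>k. fst (x k) 0) \<longlonglongrightarrow> fst x' 0 \<Longrightarrow> x' \<in> FMS Sch R f T lam \<Longrightarrow> x' \<in> E"
    for e \<eta> and E :: "'n cpath set"
  proof (rule ccontr)
    let ?bad = "\<lambda>j. \<exists>x z. (x, z) \<in> G j \<and> \<not> pdist_set Sch T x E < ereal e"
    assume "\<not> ?thesis"
    then have bad: "frequently ?bad at_top"
      unfolding not_eventually by (rule frequently_elim1, clarsimp) blast
    \<comment> \<open>Bad indices occur frequently and the smallness conditions hold eventually, so
      some index satisfies both. The chosen indices need not increase with \<open>k\<close>: the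
      explicit rates \<open>1 / real (Suc k)\<close> and \<open>real k \<le> z\<close> supply all
      the limits used below.\<close>
    have "\<exists>j x z. (x, z) \<in> G j \<and> \<not> pdist_set Sch T x E < ereal e \<and> real k \<le> z \<and>
        eps j < 1 / real (Suc k) \<and> dist (lamj j) lam < 1 / real (Suc k) \<and> dist (\<eta> j) 0 < 1 / real (Suc k)" for k
    proof -
      have "eventually (\<lambda>j. (\<forall>(x, z) \<in> G j. real k \<le> z) \<and> eps j < 1 / real (Suc k) \<and>
          dist (lamj j) lam < 1 / real (Suc k) \<and> dist (\<eta> j) 0 < 1 / real (Suc k)) at_top"
        by (intro eventually_conj z_inf[rule_format] order_tendstoD(2)[OF eps_lim]
            tendstoD[OF lamj_lim] tendstoD[OF \<eta>]) auto
      with bad have "\<exists>j. ?bad j \<and> (\<forall>(x, z) \<in> G j. real k \<le> z) \<and> eps j < 1 / real (Suc k) \<and>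
          dist (lamj j) lam < 1 / real (Suc k) \<and> dist (\<eta> j) 0 < 1 / real (Suc k)"
        by (intro frequently_ex[OF frequently_eventually_frequently])
      then show ?thesis by fast
    qed
    then obtain j x z where G: "\<And>k. (x k, z k) \<in> G (j k)"
      and x: "\<And>k. \<not> pdist_set Sch T (x k) E < ereal e" and z: "\<And>k. real k \<le> z k"
      and small: "\<And>k. eps (j k) < 1 / real (Suc k)" "\<And>k. dist (lamj (j k)) lam < 1 / real (Suc k)"
        "\<And>k. dist (\<eta> (j k)) 0 < 1 / real (Suc k)"
      by metis
    define q a y s where "q k = fst (x k)" and "a k = fst (snd (x k))" and "y k = fst (snd (snd (x k)))"
      and "s k = snd (snd (snd (x k)))" for k
    have x_eq: "(q k, a k, y k, s k) = x k" for k
      by (simp add: q_def a_def y_def s_def)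
    have paths: "((q k, a k, y k, s k), z k) \<in> fluid_scaled_paths Sch R f" for k
      unfolding x_eq using G G_sub by blast
    have z_lim: "filterlim z at_top sequentially"
      by (rule filterlim_at_top_mono[OF filterlim_real_sequentially]) (simp add: z)
    have inverse_lim: "(\<lambda>k. 1 / real (Suc k)) \<longlonglongrightarrow> 0"
      using LIMSEQ_Suc[OF lim_1_over_n] by simp
    \<comment> \<open>In the factor \<open>1 + T\<close>, the 1 accounts for the deviation from
      \<open>lamj (j k)\<close> and the \<open>T\<close> for replacing \<open>lamj (j k)\<close> by
      \<open>lam\<close> over times up to \<open>T\<close>.\<close>
    then have \<delta>: "(\<lambda>k. (1 + T) * (1 / real (Suc k))) \<longlonglongrightarrow> 0"
      by (rule tendsto_mult_right_zero)
    have a_near: "maxnorm (a k t - t *\<^sub>R lam) \<le> (1 + T) * (1 / real (Suc k))" if t: "t \<in> {0..T}" for k t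
      unfolding maxnorm_le_iff
    proof
      fix i
      have "\<bar>(a k t - t *\<^sub>R lamj (j k)) $ i\<bar> \<le> eps (j k)"
        using arr[rule_format, OF G, of k] t component_le_maxnorm[of "a k t - t *\<^sub>R lamj (j k)" i]
        by (force simp: a_def)
      moreover have "\<bar>(t *\<^sub>R lamj (j k) - t *\<^sub>R lam) $ i\<bar> \<le> T * (1 / real (Suc k))"
      proof -
        have "\<bar>(t *\<^sub>R lamj (j k) - t *\<^sub>R lam) $ i\<bar> \<le> norm (t *\<^sub>R (lamj (j k) - lam))"
          using component_le_norm_cart[of "t *\<^sub>R lamj (j k) - t *\<^sub>R lam" i] by (simp add: scaleR_right_diff_distrib)
        also have "\<dots> = t * dist (lamj (j k)) lam"
          using t by (simp add: dist_norm)
        also have "\<dots> \<le> T * (1 / real (Suc k))"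
          using t small(2)[of k] by (intro mult_mono) auto
        finally show ?thesis .
      qed
      ultimately show "\<bar>(a k t - t *\<^sub>R lam) $ i\<bar> \<le> (1 + T) * (1 / real (Suc k))"
        using small(1)[of k] unfolding distrib_right mult_1 vector_minus_component by linarith
    qed
    have q_init: "maxnorm (q k 0) \<le> K" for k
      using init[rule_format, OF G, of k] by (simp add: q_def)
    obtain r x' where r: "strict_mono (r :: nat \<Rightarrow> nat)" and x': "x' \<in> FMS Sch R f T lam"
      "(\<lambda>k. q (r k) 0) \<longlonglongrightarrow> fst x' 0"
      and near: "\<forall>e>0. eventually (\<lambda>k. pdist Sch T (q (r k), a (r k), y (r k), s (r k)) x' \<le> e) sequentially"
      by (rule fluid_limit_exists[OF net T_pos lam_nonneg paths z_lim a_near \<delta> q_init])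
    have "norm (\<eta> (j k)) \<le> 1 / real (Suc k)" for k
      using small(3)[of k] by (simp only: dist_norm diff_zero less_imp_le)
    then have "(\<lambda>k. \<eta> (j k)) \<longlonglongrightarrow> 0"
      by (intro Lim_null_comparison[OF _ inverse_lim] always_eventually allI)
    then have "(\<lambda>k. \<eta> (j (r k))) \<longlonglongrightarrow> 0"
      by (rule filterlim_compose[OF _ filterlim_subseq[OF r]])
    then have "x' \<in> E"
      using x' by (intro E[of "\<lambda>k. x (r k)" "\<lambda>k. z (r k)" "\<lambda>k. j (r k)"] G) (auto simp: q_def)
    \<comment> \<open>Half of \<open>e\<close> turns the non-strict bound into the strict one that a
      bad path violates.\<close>
    obtain k where "pdist Sch T (x (r k)) x' \<le> e / 2"
      using eventually_happens[OF near[rule_format, of "e / 2"]] e unfolding x_eq by auto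
    then have "ereal (pdist Sch T (x (r k)) x') < ereal e"
      using e by simp
    moreover have "pdist_set Sch T (x (r k)) E \<le> ereal (pdist Sch T (x (r k)) x')"
      unfolding pdist_set_def using \<open>x' \<in> E\<close> by (rule INF_lower)
    ultimately show False using x[of "r k"] by (meson le_less_trans)
  qed
  show ?thesis
  proof (intro conjI allI impI; (elim conjE)?)
    fix e :: real assume e: "0 < e"
    show "eventually (\<lambda>j. \<forall>(x, z) \<in> G j. pdist_set Sch T x (FMS_K Sch R f T lam K) < ereal e) at_top"
    \<comment> \<open>No control beyond the bound \<open>K\<close> is involved here, so
      \<open>eps\<close> merely fills the place of \<open>\<eta>\<close>; the bound on the initial
      state is closed under limits.\<close>
    proof (rule main[OF e eps_lim])
      fix x z j x' assume G: "\<And>k::nat. (x k, z k) \<in> G (j k)"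
        and lim: "(\<lambda>k. fst (x k) 0) \<longlonglongrightarrow> fst x' 0" and x': "x' \<in> FMS Sch R f T lam"
      have "\<bar>fst (x k) 0 $ i\<bar> \<le> K" for k i
        using init[rule_format, OF G, of k] by (auto simp: maxnorm_le_iff)
      then have "\<bar>fst x' 0 $ i\<bar> \<le> K" for i
        using LIMSEQ_le_const2[OF tendsto_rabs[OF tendsto_vec_nth[OF lim]]] by blast
      with x' show "x' \<in> FMS_K Sch R f T lam K"
        by (simp add: FMS_K_def maxnorm_le_iff)
    qed
  next
    fix q0 eps' and e :: real
    assume \<eta>: "(eps' \<longlongrightarrow> 0) at_top" and q0: "\<forall>j. \<forall>(x, z) \<in> G j. maxnorm (fst x 0 - q0) \<le> eps' j"
      and e: "0 < e"
    show "eventually (\<lambda>j. \<forall>(x, z) \<in> G j. pdist_set Sch T x (FMS_q0 Sch R f T lam q0) < ereal e) at_top"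
    \<comment> \<open>With \<open>eps'\<close> as the null sequence, the initial states along the
      chosen indices tend to \<open>q0\<close>, which by uniqueness of limits is the initial state
      of \<open>x'\<close>.\<close>
    proof (rule main[OF e \<eta>])
      fix x z j x' assume G: "\<And>k::nat. (x k, z k) \<in> G (j k)" and \<eta>: "(\<lambda>k. eps' (j k)) \<longlonglongrightarrow> 0"
        and lim: "(\<lambda>k. fst (x k) 0) \<longlonglongrightarrow> fst x' 0" and x': "x' \<in> FMS Sch R f T lam"
      have "norm (fst (x k) 0 - q0) \<le> eps' (j k) * real CARD('n)" for k
        using q0[rule_format, OF G, of k] norm_le_maxnorm[of "fst (x k) 0 - q0"]
        by (smt (verit) case_prod_conv mult.commute mult_left_mono of_nat_0_le_iff)
      then have "(\<lambda>k. fst (x k) 0 - q0) \<longlonglongrightarrow> 0"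
        by (intro Lim_null_comparison[OF _ tendsto_mult_left_zero[OF \<eta>]] always_eventually) auto
      then have "(\<lambda>k. fst (x k) 0) \<longlonglongrightarrow> q0"
        by (simp add: LIM_zero_iff)
      with lim x' show "x' \<in> FMS_q0 Sch R f T lam q0"
        using LIMSEQ_unique by (auto simp: FMS_q0_def)
    qed
  qed
qed

end
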